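(* Let $\Gamma$ be a countable sofic group with a sofic approximation $\Sigma$, and let $\pi\colon X\to Y$ be a factor map between dynamical systems $\Gamma\curvearrowright X$ and $\Gamma\curvearrowright Y$. Let $\rho_X$ be a dynamically generating continuous pseudometric on $X$, and let $\rho_Y,\rho_Y'$ be two dynamically generating continuous pseudometrics on $Y$. Then $$\mathrm{mdim}_\Sigma(\rho_X|\rho_Y)=\mathrm{mdim}_\Sigma(\rho_X|\rho_Y').$$ In particular, $\mathrm{mdim}_\Sigma(X|Y)=\mathrm{mdim}_\Sigma(\rho_X|\rho_Y)$.
   Context: $\Gamma$ is a countable discrete group; $\mathcal F(\Gamma)$ is the collection of nonempty finite subsets of $\Gamma$. A dynamical system $\Gamma\curvearrowright X$ is a continuous action on a compact metrizable space $X$; a factor map is a surjective continuous $\Gamma$-equivariant map. $[d]=\{1,\dots,d\}$. A compatible metric is one inducing the topology. $\dim$ is covering dimension. A pseudometric $\rho$ on $X$ is dynamically generating if $\sup_{s\in\Gamma}\rho(sx,sx')>0$ for all distinct $x,x'\in X$. Sofic approximation: a sequence of maps $\Sigma=\{\sigma_i\colon\Gamma\to\mathrm{Sym}(d_i)\}_{i\in\mathbb N}$ (not necessarily homomorphisms; write $\sigma_{i,s}=\sigma_i(s)$) with (1) $|\{v\in[d_i]:\sigma_{i,s}\sigma_{i,t}(v)=\sigma_{i,st}(v)\}|/d_i\to1$ for all $s,t\in\Gamma$; (2) $|\{v\in[d_i]:\sigma_{i,s}(v)\ne\sigma_{i,t}(v)\}|/d_i\to1$ for all distinct $s,t$; (3)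 $d_i\to\infty$. $\Gamma$ is sofic if it has a sofic approximation. For a continuous pseudometric $\rho$ on $Z$ and $\varphi,\psi\in Z^{[d]}$: $\rho_{2}(\varphi,\psi)=\big(\frac1d\sum_{v}\rho(\varphi(v),\psi(v))^2\big)^{1/2}$, $\rho_{\infty}(\varphi,\psi)=\max_v\rho(\varphi(v),\psi(v))$; these are written $\rho_{X,2},\rho_{X,\infty}$ for $\rho=\rho_X$, etc. For $F\in\mathcal F(\Gamma)$, $\delta>0$, $\sigma\colon\Gamma\to\mathrm{Sym}(d)$, $$\mathrm{Map}(\rho_X,F,\delta,\sigma)=\{\varphi\colon[d]\to X:\ \rho_{X,2}(s\varphi,\varphi\circ\sigma(s))\le\delta\ \text{for all } s\in F\},\quad (s\varphi)(v)=s(\varphi(v)).$$ For continuous pseudometrics $\rho_X,\rho_Y$ on $X,Y$, $\mathcal K\subseteq X^{[d]}$ and $\varepsilon,\theta>0$, $\mathrm{Wdim}_\varepsilon(\mathcal K,\theta,\rho_{X,\infty}|\rho_{Y,\infty})$ is the minimal $\dim P$ over compact metrizable $P$ admitting a continuous $f\colon\mathcal K\to P$ such that $\rho_{X,\infty}(\varphi,\varphi')<\varepsilon$ whenever $f(\varphi)=f(\varphi')$ and $\rho_{Y,\infty}(\pi\circ\varphi,\pi\circ\varphi')\le\theta$. Set $$\mathrm{mdim}_\Sigma(\rho_X|\rho_Y)=\sup_{\varepsilon>0}\inf_{\theta>0}\inf_{F\in\mathcal F(\Gamma)}\inf_{\delta>0}\limsup_{i\to\infty}\frac1{d_i}\mathrm{Wdim}_\varepsilon(\mathrm{Map}(\rho_X,F,\delta,\sigma_i),\theta,\rho_{X,\infty}|\rho_{Y,\infty}),$$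 where the $\limsup$ is $-\infty$ if the $\mathrm{Map}$ sets are empty for all large $i$. $\mathrm{mdim}_\Sigma(X|Y)$ is defined as $\mathrm{mdim}_\Sigma(\rho_X|\rho_Y)$ for compatible metrics $\rho_X,\rho_Y$ (independent of the compatible metrics chosen). *)

theory Defs
  imports "HOL-Analysis.Analysis" "HOL-Algebra.Group_Action" "HOL-Algebra.Sym_Groups"
begin

text \<open>Compact metrizable spaces are abstract topologies, so that the empty space is allowed.
  As the group is discrete, an action is continuous iff each group element acts continuously.\<close>

definition dynamical_system ::
  "('g, 'm) monoid_scheme \<Rightarrow> 'x topology \<Rightarrow> ('g \<Rightarrow> 'x \<Rightarrow> 'x) \<Rightarrow> bool" where
  "dynamical_system \<Gamma> X \<alpha> \<longleftrightarrow>
     compact_space X \<and> metrizable_space X \<and>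
     group_action \<Gamma> (topspace X) \<alpha> \<and>
     (\<forall>s\<in>carrier \<Gamma>. continuous_map X X (\<alpha> s))"

definition factor_map ::
  "('g, 'm) monoid_scheme \<Rightarrow> 'x topology \<Rightarrow> ('g \<Rightarrow> 'x \<Rightarrow> 'x) \<Rightarrow>
   'y topology \<Rightarrow> ('g \<Rightarrow> 'y \<Rightarrow> 'y) \<Rightarrow> ('x \<Rightarrow> 'y) \<Rightarrow> bool" where
  "factor_map \<Gamma> X \<alpha> Y \<beta> \<pi> \<longleftrightarrow>
     continuous_map X Y \<pi> \<and> \<pi> ` topspace X = topspace Y \<and>
     (\<forall>s\<in>carrier \<Gamma>. \<forall>x\<in>topspace X. \<pi> (\<alpha> s x) = \<beta> s (\<pi> x))"

definition continuous_pseudometric :: "'x topology \<Rightarrow> ('x \<Rightarrow> 'x \<Rightarrow> real) \<Rightarrow> bool" where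
  "continuous_pseudometric X \<rho> \<longleftrightarrow>
     (\<forall>x\<in>topspace X. \<rho> x x = 0) \<and>
     (\<forall>x\<in>topspace X. \<forall>y\<in>topspace X. 0 \<le> \<rho> x y \<and> \<rho> x y = \<rho> y x) \<and>
     (\<forall>x\<in>topspace X. \<forall>y\<in>topspace X. \<forall>z\<in>topspace X. \<rho> x z \<le> \<rho> x y + \<rho> y z) \<and>
     continuous_map (prod_topology X X) euclideanreal (\<lambda>(x, y). \<rho> x y)"

text \<open>The real supremum below is meaningful because a continuous pseudometric on a compact space
  is bounded.\<close>

definition dynamically_generating ::
  "('g, 'm) monoid_scheme \<Rightarrow> 'x topology \<Rightarrow> ('g \<Rightarrow> 'x \<Rightarrow> 'x) \<Rightarrow> ('x \<Rightarrow> 'x \<Rightarrow> real) \<Rightarrow> bool" where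
  "dynamically_generating \<Gamma> X \<alpha> \<rho> \<longleftrightarrow>
     (\<forall>x\<in>topspace X. \<forall>x'\<in>topspace X. x \<noteq> x' \<longrightarrow> (SUP s\<in>carrier \<Gamma>. \<rho> (\<alpha> s x) (\<alpha> s x')) > 0)"

definition compatible_metric :: "'x topology \<Rightarrow> ('x \<Rightarrow> 'x \<Rightarrow> real) \<Rightarrow> bool" where
  "compatible_metric X \<rho> \<longleftrightarrow>
     Metric_space (topspace X) \<rho> \<and> Metric_space.mtopology (topspace X) \<rho> = X"

definition sofic_approximation ::
  "('g, 'm) monoid_scheme \<Rightarrow> (nat \<Rightarrow> nat) \<Rightarrow> (nat \<Rightarrow> 'g \<Rightarrow> nat \<Rightarrow> nat) \<Rightarrow> bool" where
  "sofic_approximation \<Gamma> d \<sigma> \<longleftrightarrow>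
     (\<forall>i. \<forall>s\<in>carrier \<Gamma>. \<sigma> i s \<in> carrier (sym_group (d i))) \<and>
     (\<forall>s\<in>carrier \<Gamma>. \<forall>t\<in>carrier \<Gamma>.
        (\<lambda>i. real (card {v\<in>{1..d i}. \<sigma> i s (\<sigma> i t v) = \<sigma> i (s \<otimes>\<^bsub>\<Gamma>\<^esub> t) v}) / real (d i))
          \<longlonglongrightarrow> 1) \<and>
     (\<forall>s\<in>carrier \<Gamma>. \<forall>t\<in>carrier \<Gamma>. s \<noteq> t \<longrightarrow>
        (\<lambda>i. real (card {v\<in>{1..d i}. \<sigma> i s v \<noteq> \<sigma> i t v}) / real (d i)) \<longlonglongrightarrow> 1) \<and>
     filterlim d at_top sequentially"

text \<open>The degenerate value \<open>d = 0\<close>, where \<open>rho_inf\<close> is unspecified, occurs only finitely often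
  along a sofic approximation and does not affect any of the limits.\<close>

definition rho_2 :: "nat \<Rightarrow> ('z \<Rightarrow> 'z \<Rightarrow> real) \<Rightarrow> (nat \<Rightarrow> 'z) \<Rightarrow> (nat \<Rightarrow> 'z) \<Rightarrow> real" where
  "rho_2 d \<rho> \<phi> \<psi> = sqrt (1 / real d * (\<Sum>v\<in>{1..d}. (\<rho> (\<phi> v) (\<psi> v))\<^sup>2))"

definition rho_inf :: "nat \<Rightarrow> ('z \<Rightarrow> 'z \<Rightarrow> real) \<Rightarrow> (nat \<Rightarrow> 'z) \<Rightarrow> (nat \<Rightarrow> 'z) \<Rightarrow> real" where
  "rho_inf d \<rho> \<phi> \<psi> = (MAX v\<in>{1..d}. \<rho> (\<phi> v) (\<psi> v))"

definition Map_sofic ::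
  "'x topology \<Rightarrow> ('g \<Rightarrow> 'x \<Rightarrow> 'x) \<Rightarrow> ('x \<Rightarrow> 'x \<Rightarrow> real) \<Rightarrow> 'g set \<Rightarrow> real \<Rightarrow>
   nat \<Rightarrow> ('g \<Rightarrow> nat \<Rightarrow> nat) \<Rightarrow> (nat \<Rightarrow> 'x) set" where
  "Map_sofic X \<alpha> \<rho> F \<delta> d \<sigma> =
     {\<phi> \<in> {1..d} \<rightarrow>\<^sub>E topspace X. \<forall>s\<in>F. rho_2 d \<rho> (\<lambda>v. \<alpha> s (\<phi> v)) (\<phi> \<circ> \<sigma> s) \<le> \<delta>}"

text \<open>Covering dimension is the least \<open>k - 1\<close> such that every finite open cover has a finite open
  refinement with at most \<open>k\<close> members through each point; thus the empty space has dimension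
  \<open>-1\<close>, and the dimension is \<open>\<infinity>\<close> if there is no such \<open>k\<close>.\<close>

definition finite_open_cover :: "'p topology \<Rightarrow> 'p set set \<Rightarrow> bool" where
  "finite_open_cover P \<U> \<longleftrightarrow> finite \<U> \<and> (\<forall>U\<in>\<U>. openin P U) \<and> \<Union>\<U> = topspace P"

definition covering_dim :: "'p topology \<Rightarrow> ereal" where
  "covering_dim P =
     (INF k\<in>{k::nat. \<forall>\<U>. finite_open_cover P \<U> \<longrightarrow>
                  (\<exists>\<V>. finite_open_cover P \<V> \<and> (\<forall>V\<in>\<V>. \<exists>U\<in>\<U>. V \<subseteq> U) \<and>
                       (\<forall>p\<in>topspace P. card {V\<in>\<V>. p \<in> V} \<le> k))}.
        ereal (real k - 1))"

text \<open>The space \<open>P\<close> ranges over all compact metrizable topologies whose points are taken from the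
  type \<^typ>\<open>nat \<Rightarrow> real\<close>. This is no restriction: a compact metrizable space has at most continuum
  many points, hence is homeomorphic to one of these.\<close>

definition Wdim ::
  "'x topology \<Rightarrow> ('x \<Rightarrow> 'y) \<Rightarrow> nat \<Rightarrow> real \<Rightarrow> (nat \<Rightarrow> 'x) set \<Rightarrow> real \<Rightarrow>
   ('x \<Rightarrow> 'x \<Rightarrow> real) \<Rightarrow> ('y \<Rightarrow> 'y \<Rightarrow> real) \<Rightarrow> ereal" where
  "Wdim X \<pi> d \<epsilon> K \<theta> \<rho>X \<rho>Y =
     (INF P\<in>{P :: (nat \<Rightarrow> real) topology. compact_space P \<and> metrizable_space P \<and>
              (\<exists>f. continuous_map (subtopology (product_topology (\<lambda>_. X) {1..d}) K) P f \<and>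
                   (\<forall>\<phi>\<in>K. \<forall>\<phi>'\<in>K.
                      f \<phi> = f \<phi>' \<and> rho_inf d \<rho>Y (\<pi> \<circ> \<phi>) (\<pi> \<circ> \<phi>') \<le> \<theta> \<longrightarrow> rho_inf d \<rho>X \<phi> \<phi>' < \<epsilon>))}.
        covering_dim P)"

definition mdim ::
  "('g, 'm) monoid_scheme \<Rightarrow> (nat \<Rightarrow> nat) \<Rightarrow> (nat \<Rightarrow> 'g \<Rightarrow> nat \<Rightarrow> nat) \<Rightarrow>
   'x topology \<Rightarrow> ('g \<Rightarrow> 'x \<Rightarrow> 'x) \<Rightarrow> ('x \<Rightarrow> 'y) \<Rightarrow>
   ('x \<Rightarrow> 'x \<Rightarrow> real) \<Rightarrow> ('y \<Rightarrow> 'y \<Rightarrow> real) \<Rightarrow> ereal" where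
  "mdim \<Gamma> d \<sigma> X \<alpha> \<pi> \<rho>X \<rho>Y =
     (SUP \<epsilon>\<in>{0<..}. INF \<theta>\<in>{0<..}. INF F\<in>{F. finite F \<and> F \<noteq> {} \<and> F \<subseteq> carrier \<Gamma>}. INF \<delta>\<in>{0<..}.
        if \<forall>\<^sub>F i in sequentially. Map_sofic X \<alpha> \<rho>X F \<delta> (d i) (\<sigma> i) = {} then - \<infinity>
        else limsup (\<lambda>i. Wdim X \<pi> (d i) \<epsilon> (Map_sofic X \<alpha> \<rho>X F \<delta> (d i) (\<sigma> i)) \<theta> \<rho>X \<rho>Y
                          / ereal (real (d i))))"

text \<open>The common value of \<^const>\<open>mdim\<close> over all pairs of compatible metrics.\<close>

definition mdim_rel ::
  "('g, 'm) monoid_scheme \<Rightarrow> (nat \<Rightarrow> nat) \<Rightarrow> (nat \<Rightarrow> 'g \<Rightarrow> nat \<Rightarrow> nat) \<Rightarrow>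
   'x topology \<Rightarrow> ('g \<Rightarrow> 'x \<Rightarrow> 'x) \<Rightarrow> 'y topology \<Rightarrow> ('x \<Rightarrow> 'y) \<Rightarrow> ereal" where
  "mdim_rel \<Gamma> d \<sigma> X \<alpha> Y \<pi> =
     (THE m. \<forall>\<rho>X \<rho>Y. compatible_metric X \<rho>X \<and> compatible_metric Y \<rho>Y \<longrightarrow>
                       mdim \<Gamma> d \<sigma> X \<alpha> \<pi> \<rho>X \<rho>Y = m)"

end

theory Submission
  imports Defs
begin

text \<open>
  A continuous map into a space of covering dimension below \<open>k\<close> that separates the points of a compact
  set \<open>B\<close> of pairs can be replaced by finitely many real functions of which at most \<open>k\<close> are
  nonzero at each point (the distances to the complements of the members of a fine cover), and
  conversely the image of such a family of functions has dimension at most \<open>k\<close>. So, up to an additive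
  error of \<open>1\<close>, \<open>Wdim\<close> counts nonzero functions, and neither a product nor a sum theorem for dimension
  is needed.

  Compactness and the generating property make every continuous pseudometric small as soon as
  finitely many translates of a generating one are. Hence a map \<open>\<phi>\<close> that is almost equivariant for
  one generating pseudometric is so for every continuous pseudometric, and \<open>\<rho>Y\<close>-closeness of \<open>\<pi> \<circ> \<phi>\<close>
  and \<open>\<pi> \<circ> \<phi>'\<close> at all coordinates gives \<open>\<rho>Y'\<close>-closeness at all coordinates \<open>v\<close> but the few where
  \<open>\<phi>\<close> or \<open>\<phi>'\<close> fails to be equivariant. At such a coordinate \<open>\<phi> v\<close> is recorded approximately by
  boundedly many additional functions that vanish wherever \<open>\<phi>\<close> is almost equivariant; they change
  \<open>Wdim\<close> by a small multiple of \<open>d\<close>. The same argument exchanges \<open>\<rho>X\<close>.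
\<close>

subsection \<open>Covering dimension of sets of sparse vectors\<close>


lemma covering_dim_leI:
  assumes "\<And>\<U>. finite_open_cover P \<U> \<Longrightarrow>
             \<exists>\<V>. finite_open_cover P \<V> \<and> (\<forall>V\<in>\<V>. \<exists>U\<in>\<U>. V \<subseteq> U) \<and>
                 (\<forall>p\<in>topspace P. card {V\<in>\<V>. p \<in> V} \<le> k)"
  shows "covering_dim P \<le> ereal (real k - 1)"
  unfolding covering_dim_def by (rule INF_lower) (use assms in blast)

text \<open>The metric on \<open>nat \<Rightarrow> real\<close> is a series of truncated coordinate
  distances with weights \<open>(1/2)^n\<close>, and these weights sum to 2.\<close>

lemma dist_nat_fun_le:
  fixes x y :: "nat \<Rightarrow> real"
  assumes "\<And>j. dist (x j) (y j) \<le> h"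
  shows "dist x y \<le> 2 * h"
proof -
  have s: "summable (\<lambda>n. (1/2)^n * h)" for h :: real
    by (intro summable_mult2 summable_geometric) auto
  have "dist x y = (\<Sum>n. (1/2)^n * min (dist (x (from_nat n)) (y (from_nat n))) 1)"
    by (rule dist_fun_def)
  also have "\<dots> \<le> (\<Sum>n. (1/2)^n * h)"
  proof (rule suminf_le)
    show "summable (\<lambda>n. (1/2)^n * min (dist (x (from_nat n)) (y (from_nat n))) 1)"
      by (rule summable_comparison_test'[OF s[of 1], of 0])
        (auto simp: abs_mult power_abs intro!: mult_left_le)
    show "(1/2)^n * min (dist (x (from_nat n)) (y (from_nat n))) 1 \<le> (1/2)^n * h" for n
      using assms[of "from_nat n"] by (intro mult_left_mono) auto
  qed (rule s)
  also have "\<dots> = 2 * h"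
    by (subst suminf_mult2[symmetric]) (auto simp: suminf_geometric summable_geometric)
  finally show ?thesis .
qed

text \<open>Colour \<open>i\<close> consists of the open cells of the grid of mesh \<open>h\<close> shifted by \<open>h * c i\<close>. The offsets
  \<open>c i\<close> are distinct elements of \<open>(0, 1)\<close>, so a nonzero coordinate lies on a wall for at most one
  colour and a zero coordinate for none: with at most \<open>r\<close> nonzero coordinates, one of the \<open>r + 1\<close>
  colours covers the point.\<close>

lemma covering_dim_sparse_le:
  fixes E :: "(nat \<Rightarrow> real) set"
  assumes E: "compact E"
    and supp: "\<And>w j. w \<in> E \<Longrightarrow> j \<ge> n \<Longrightarrow> w j = 0"
    and card: "\<And>w. w \<in> E \<Longrightarrow> card {j. j < n \<and> w j \<noteq> 0} \<le> r"
  shows "covering_dim (top_of_set E) \<le> ereal (real r)"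
proof -
  have "covering_dim (top_of_set E) \<le> ereal (real (Suc r) - 1)"
  proof (rule covering_dim_leI)
    fix \<U> assume \<U>: "finite_open_cover (top_of_set E) \<U>"
    define \<G> where "\<G> = {G. open G \<and> (\<exists>U\<in>\<U>. E \<inter> G = U)}"
    have "E \<subseteq> \<Union>\<G>"
    proof
      fix x assume "x \<in> E"
      then obtain U where "U \<in> \<U>" "x \<in> U" using \<U> by (auto simp: finite_open_cover_def)
      moreover then obtain G where "open G" "U = E \<inter> G"
        using \<U> unfolding finite_open_cover_def openin_open by metis
      ultimately show "x \<in> \<Union>\<G>" by (auto simp: \<G>_def)
    qed
    \<comment> \<open>A Lebesgue number of the cover: every ball of radius \<open>e\<close> about a
      point of \<open>E\<close> lies in a member of \<open>\<G>\<close>.\<close>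
    then obtain e where e: "e > 0" "\<And>x. x \<in> E \<Longrightarrow> \<exists>G\<in>\<G>. ball x e \<subseteq> G"
      using Heine_Borel_lemma[OF E, of \<G>] unfolding \<G>_def by blast
    \<comment> \<open>Points of one cell differ by at most \<open>h\<close> in each coordinate, so
      their distance is at most \<open>2 * h < e\<close>.\<close>
    define h where "h = e / 3"
    have h: "h > 0" using e by (simp add: h_def)
    define c where "c i = (real i + 1) / (real r + 2)" for i
    define B where "B i z = E \<inter> (\<Inter>j\<in>{..<n}. {w. h * (of_int (z j) + c i) < w j} \<inter>
                                 {w. w j < h * (of_int (z j) + 1 + c i)})" for i and z :: "nat \<Rightarrow> int"
    have c01: "0 < c i" "c i < 1" if "i \<le> r" for i using that by (auto simp: c_def)
    have B_open: "openin (top_of_set E) (B i z)" for i z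
      unfolding B_def
      by (intro openin_open_Int open_INT ballI open_Int open_Collect_less continuous_on_const
            continuous_on_product_coordinates) auto
    have B_small: "\<exists>U\<in>\<U>. B i z \<subseteq> U" if ne: "B i z \<noteq> {}" for i z
    proof -
      obtain x where x: "x \<in> B i z" using ne by blast
      then have "x \<in> E" by (auto simp: B_def)
      then obtain G where G: "G \<in> \<G>" "ball x e \<subseteq> G" using e by blast
      have "B i z \<subseteq> E \<inter> G"
      proof
        fix y assume y: "y \<in> B i z"
        have "dist (x j) (y j) \<le> h" for j
        proof (cases "j < n")
          case True
          then have "h * (of_int (z j) + c i) < x j" "x j < h * (of_int (z j) + 1 + c i)"
            "h * (of_int (z j) + c i) < y j" "y j < h * (of_int (z j) + 1 + c i)"
            using x y by (auto simp: B_def)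
          then show ?thesis by (auto simp: dist_real_def algebra_simps abs_le_iff)
        next
          case False
          then have "x j = 0" "y j = 0" using supp x y by (auto simp: B_def)
          then show ?thesis using h by simp
        qed
        then have "dist x y \<le> 2 * h" by (rule dist_nat_fun_le)
        then have "y \<in> ball x e" using e by (auto simp: h_def)
        then show "y \<in> E \<inter> G" using G y by (auto simp: B_def)
      qed
      then show ?thesis using G unfolding \<G>_def by blast
    qed
    \<comment> \<open>\<open>Z p i\<close> indexes the only cell of colour \<open>i\<close> that can
      contain \<open>p\<close>. Indices may differ beyond \<open>n\<close>, but \<open>B i z\<close>
      depends only on the coordinates below \<open>n\<close>, so as a set the cell is
      unique.\<close>
    define Z where "Z p i = (\<lambda>j. \<lfloor>p j / h - c i\<rfloor>)" for p :: "nat \<Rightarrow> real" and i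
    have B_unique: "B i z = B i (Z p i)" if "p \<in> B i z" for i z p
    proof -
      have "z j = Z p i j" if "j < n" for j
      proof -
        have "h * (of_int (z j) + c i) < p j" "p j < h * (of_int (z j) + 1 + c i)"
          using \<open>p \<in> B i z\<close> that by (auto simp: B_def)
        then have "of_int (z j) < p j / h - c i" "p j / h - c i < of_int (z j) + 1"
          using h by (auto simp: field_simps)
        then show ?thesis unfolding Z_def by linarith
      qed
      then show ?thesis by (auto simp: B_def)
    qed
    have B_cover: "\<exists>i\<le>r. p \<in> B i (Z p i)" if p: "p \<in> E" for p
    proof -
      \<comment> \<open>The colours with a wall through \<open>p j\<close>. A wall at 0 would make
        \<open>c i\<close> an integer, which \<open>0 < c i < 1\<close> forbids; two colours sharing
        a wall would have offsets differing by an integer of modulus below 1, hence by 0.\<close>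
      define bad where "bad j = {i. i \<le> r \<and> (\<exists>m::int. p j = h * (of_int m + c i))}" for j
      have bad0: "bad j = {}" if "p j = 0" for j
      proof -
        have "of_int m + c i \<noteq> 0" if "i \<le> r" for m :: int and i
        proof
          assume "of_int m + c i = 0"
          then have "(0::real) < of_int (-m)" "of_int (-m) < (1::real)" using c01[OF that] by auto
          then have "0 < -m" "-m < 1" by linarith+
          then show False by linarith
        qed
        then show ?thesis using that h by (auto simp: bad_def)
      qed
      have bad1: "card (bad j) \<le> 1" for j
      proof -
        have "i = i'" if "i \<in> bad j" "i' \<in> bad j" for i i'
        proof -
          obtain m m' :: int where m: "p j = h * (of_int m + c i)" "p j = h * (of_int m' + c i')"
            and "i \<le> r" "i' \<le> r"
            using \<open>i \<in> bad j\<close> \<open>i' \<in> bad j\<close> unfolding bad_def by blast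
          then have "of_int m + c i = of_int m' + c i'" using h by simp
          then have "of_int (m - m') = c i' - c i" by simp
          moreover have "\<bar>c i' - c i\<bar> < 1" using c01[OF \<open>i \<le> r\<close>] c01[OF \<open>i' \<le> r\<close>] by linarith
          ultimately have "m - m' = 0" by linarith
          then have "c i = c i'" using \<open>of_int m + c i = of_int m' + c i'\<close> by simp
          then show ?thesis by (simp add: c_def divide_simps split: if_splits)
        qed
        then show ?thesis by (simp add: card_le_Suc0_iff_eq bad_def)
      qed
      define J where "J = {j. j < n \<and> p j \<noteq> 0}"
      have "card (\<Union>j\<in>{..<n}. bad j) \<le> card (\<Union>j\<in>J. bad j)"
        by (rule card_mono) (use bad0 in \<open>auto simp: J_def bad_def\<close>)
      also have "\<dots> \<le> (\<Sum>j\<in>J. card (bad j))" by (rule card_UN_le) (auto simp: J_def)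
      also have "\<dots> \<le> (\<Sum>j\<in>J. 1)" by (rule sum_mono) (use bad1 in auto)
      also have "\<dots> \<le> r" using card[OF p] by (simp add: J_def)
      \<comment> \<open>Each of the at most \<open>r\<close> nonzero coordinates spoils at most one
        of the \<open>r + 1\<close> colours, so some colour survives.\<close>
      finally have "card (\<Union>j\<in>{..<n}. bad j) < card {..r}" by simp
      then have "\<not> {..r} \<subseteq> (\<Union>j\<in>{..<n}. bad j)"
        using card_mono[of "\<Union>j\<in>{..<n}. bad j" "{..r}"] by (auto simp: bad_def)
      then obtain i where i: "i \<le> r" "\<And>j. j < n \<Longrightarrow> i \<notin> bad j" by auto
      have "p \<in> B i (Z p i)"
        unfolding B_def
      proof (intro IntI INT_I CollectI)
        show "p \<in> E" by fact
        fix j assume "j \<in> {..<n}"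
        then have ne: "p j \<noteq> h * (of_int (Z p i j) + c i)" using i by (auto simp: bad_def)
        have "of_int (Z p i j) \<le> p j / h - c i" "p j / h - c i < of_int (Z p i j) + 1"
          unfolding Z_def by linarith+
        then have "h * (of_int (Z p i j) + c i) \<le> p j" "p j < h * (of_int (Z p i j) + 1 + c i)"
          using h by (auto simp: field_simps)
        then show "h * (of_int (Z p i j) + c i) < p j" "p j < h * (of_int (Z p i j) + 1 + c i)"
          using ne by auto
      qed
      then show ?thesis using i by blast
    qed
    define \<B> where "\<B> = {B i z |i z. i \<le> r \<and> B i z \<noteq> {}}"
    have "compact_space (top_of_set E)" using E by (simp add: compact_space_subtopology)
    moreover have "\<forall>V\<in>\<B>. openin (top_of_set E) V" using B_open unfolding \<B>_def by blast
    moreover have "topspace (top_of_set E) \<subseteq> \<Union>\<B>"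
    proof
      fix p assume "p \<in> topspace (top_of_set E)"
      then obtain i where "i \<le> r" "p \<in> B i (Z p i)" using B_cover by auto
      then show "p \<in> \<Union>\<B>" unfolding \<B>_def by blast
    qed
    \<comment> \<open>Compactness leaves finitely many cells, and passing to a subfamily cannot
      raise the multiplicity.\<close>
    ultimately obtain \<V> where \<V>: "finite \<V>" "\<V> \<subseteq> \<B>" "topspace (top_of_set E) \<subseteq> \<Union>\<V>"
      unfolding compact_space_alt by meson
    have op: "openin (top_of_set E) V" if V: "V \<in> \<V>" for V
      using V \<V>(2) B_open unfolding \<B>_def by blast
    then have "\<Union>\<V> \<subseteq> topspace (top_of_set E)" by (meson Union_least openin_subset)
    then have "finite_open_cover (top_of_set E) \<V>"
      using \<V> op unfolding finite_open_cover_def by blast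
    moreover have "\<forall>V\<in>\<V>. \<exists>U\<in>\<U>. V \<subseteq> U" using \<V>(2) B_small unfolding \<B>_def by blast
    moreover have "card {V\<in>\<V>. p \<in> V} \<le> Suc r" for p
    proof -
      \<comment> \<open>One cell per colour: multiplicity \<open>r + 1\<close>, which is dimension
        \<open>r\<close>.\<close>
      have "{V\<in>\<V>. p \<in> V} \<subseteq> (\<lambda>i. B i (Z p i)) ` {..r}"
      proof
        fix V assume "V \<in> {V\<in>\<V>. p \<in> V}"
        then obtain i z where "V = B i z" "i \<le> r" "p \<in> B i z" using \<V>(2) unfolding \<B>_def by blast
        then show "V \<in> (\<lambda>i. B i (Z p i)) ` {..r}" using B_unique[of p i z] by blast
      qed
      then have "card {V\<in>\<V>. p \<in> V} \<le> card {..r}" by (rule surj_card_le[rotated]) simp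
      then show ?thesis by simp
    qed
    ultimately show "\<exists>\<V>. finite_open_cover (top_of_set E) \<V> \<and> (\<forall>V\<in>\<V>. \<exists>U\<in>\<U>. V \<subseteq> U) \<and>
                 (\<forall>p\<in>topspace (top_of_set E). card {V\<in>\<V>. p \<in> V} \<le> Suc r)" by blast
  qed
  then show ?thesis by simp
qed

text \<open>Listed along an enumeration of \<open>J\<close> and padded with zeros, the functions
  form one map into \<open>nat \<Rightarrow> real\<close>. Its image is a compact set of sparse
  vectors and serves as \<open>P\<close>.\<close>

lemma sparse_functions_imp_covering_dim_le:
  fixes T :: "'a topology" and g :: "'j \<Rightarrow> 'a \<Rightarrow> real"
  assumes T: "compact_space T" and J: "finite J"
    and cont: "\<And>j. j \<in> J \<Longrightarrow> continuous_map T euclideanreal (g j)"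
    and card: "\<And>a. a \<in> topspace T \<Longrightarrow> card {j\<in>J. g j a \<noteq> 0} \<le> r"
  obtains P :: "(nat \<Rightarrow> real) topology" and f
  where "compact_space P" "metrizable_space P" "covering_dim P \<le> ereal (real r)"
    "continuous_map T P f" "\<forall>a a'. f a = f a' \<longrightarrow> (\<forall>j\<in>J. g j a = g j a')"
proof -
  obtain n and b :: "nat \<Rightarrow> 'j" where b: "bij_betw b {..<n} J"
    using ex_bij_betw_nat_finite[OF J] by (auto simp: atLeast0LessThan)
  define f where "f a = (\<lambda>j. if j < n then g (b j) a else 0)" for a
  define E where "E = f ` topspace T"
  have "continuous_map T euclidean f"
    unfolding euclidean_product_topology[symmetric] continuous_map_componentwise_UNIV
  proof
    fix j show "continuous_map T euclideanreal (\<lambda>a. f a j)"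
      using cont[of "b j"] b by (cases "j < n") (auto simp: f_def bij_betw_def)
  qed
  then have f: "continuous_map T (top_of_set E) f"
    by (auto simp: continuous_map_in_subtopology E_def)
  have "compact E"
    using \<open>continuous_map T euclidean f\<close> T image_compactin[of T "topspace T" euclidean f]
    by (simp add: E_def compact_space_def)
  moreover have "card {j. j < n \<and> f a j \<noteq> 0} \<le> r" if a: "a \<in> topspace T" for a
  proof -
    have "card {j. j < n \<and> f a j \<noteq> 0} = card (b ` {j. j < n \<and> f a j \<noteq> 0})"
      by (rule card_image[symmetric], rule inj_on_subset[of _ "{..<n}"])
        (use b in \<open>auto simp: bij_betw_def\<close>)
    also have "\<dots> \<le> card {j\<in>J. g j a \<noteq> 0}"
      by (rule card_mono) (use J b in \<open>auto simp: bij_betw_def f_def\<close>)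
    finally show ?thesis using card[OF a] by simp
  qed
  ultimately have "covering_dim (top_of_set E) \<le> ereal (real r)"
    by (intro covering_dim_sparse_le[where n = n]) (auto simp: E_def f_def)
  moreover have "compact_space (top_of_set E)" using \<open>compact E\<close> by (simp add: compact_space_subtopology)
  moreover have "metrizable_space (top_of_set E)"
    by (simp add: metrizable_space_subtopology metrizable_space_euclidean)
  moreover have "g j a = g j a'" if "f a = f a'" "j \<in> J" for a a' j
  proof -
    obtain i where "i < n" "j = b i" using b \<open>j \<in> J\<close> by (auto simp: bij_betw_def)
    then show ?thesis using fun_cong[OF \<open>f a = f a'\<close>, of i] by (simp add: f_def)
  qed
  ultimately show ?thesis using f that by blast
qed


section \<open>Sparse functions from fine covers\<close>

text \<open>By compactness of \<open>B\<close>, the images under \<open>f\<close> of its pairs stay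
  a distance \<open>e\<close> apart, so no member of a fine cover contains both. The distance to the
  complement of a member is nonzero exactly on that member, hence the multiplicity \<open>k\<close>
  of the cover bounds the number of nonzero functions.\<close>

lemma refinement_imp_sparse_functions:
  fixes T :: "'a topology" and P :: "'p topology"
  assumes P: "compact_space P" "metrizable_space P" and f: "continuous_map T P f"
    and k: "\<And>\<U>. finite_open_cover P \<U> \<Longrightarrow>
              \<exists>\<V>. finite_open_cover P \<V> \<and> (\<forall>V\<in>\<V>. \<exists>U\<in>\<U>. V \<subseteq> U) \<and>
                  (\<forall>p\<in>topspace P. card {V\<in>\<V>. p \<in> V} \<le> k)"
    and B: "compactin (prod_topology T T) B" and sep: "\<And>a a'. (a, a') \<in> B \<Longrightarrow> f a \<noteq> f a'"
  obtains J :: "'p set set" and g where "finite J"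
    "\<forall>j\<in>J. continuous_map T euclideanreal (g j)"
    "\<forall>a\<in>topspace T. card {j\<in>J. g j a \<noteq> 0} \<le> k"
    "\<forall>(a, a')\<in>B. \<exists>j\<in>J. g j a \<noteq> g j a'"
proof -
  obtain M D where "Metric_space M D" and PM: "P = Metric_space.mtopology M D"
    using P by (auto simp: metrizable_space_def)
  interpret Metric_space M D by fact
  have top: "topspace P = M" by (simp add: PM)
  have fM: "f a \<in> M" if "a \<in> topspace T" for a
    using continuous_map_funspace[OF f] that by (auto simp: top)
  have BT: "a \<in> topspace T" "a' \<in> topspace T" if "(a, a') \<in> B" for a a'
    using compactin_subset_topspace[OF B] that by auto
  have "continuous_map (prod_topology T T) euclideanreal (\<lambda>x. D (f (fst x)) (f (snd x)))"
  proof -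
    have "continuous_map (prod_topology T T) (mtopology_of (metric (M, D))) (\<lambda>x. f (fst x))"
      "continuous_map (prod_topology T T) (mtopology_of (metric (M, D))) (\<lambda>x. f (snd x))"
      using f continuous_map_compose[OF continuous_map_fst f] continuous_map_compose[OF continuous_map_snd f]
      by (auto simp: PM mtopology_of_def o_def)
    from continuous_map_mdist[OF this] show ?thesis by (simp add: mdist_metric)
  qed
  then have comp: "compact ((\<lambda>x. D (f (fst x)) (f (snd x))) ` B)"
    using image_compactin[OF B] by fastforce
  \<comment> \<open>The distance attains its minimum on \<open>B\<close>, which is positive by
    \<open>sep\<close>; for empty \<open>B\<close> any \<open>e\<close> will do.\<close>
  obtain e where e: "e > 0" "\<And>a a'. (a, a') \<in> B \<Longrightarrow> D (f a) (f a') \<ge> e"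
  proof (cases "B = {}")
    case False
    then obtain a0 a0' where 0: "(a0, a0') \<in> B"
      "\<And>a a'. (a, a') \<in> B \<Longrightarrow> D (f a0) (f a0') \<le> D (f a) (f a')"
      using compact_attains_inf[OF comp] by fastforce
    moreover have "D (f a0) (f a0') > 0" using sep BT fM 0 by (metis mdist_pos_less)
    ultimately show thesis using that by blast
  qed (use that[of 1] in auto)
  \<comment> \<open>Radius \<open>e/2\<close> makes any two points of one ball closer than
    \<open>e\<close>; refinements inherit this.\<close>
  have "\<forall>U\<in>(\<lambda>x. mball x (e/2)) ` M. openin P U" by (auto simp: PM)
  moreover have "topspace P \<subseteq> \<Union>((\<lambda>x. mball x (e/2)) ` M)" using e by (auto simp: top)
  ultimately obtain \<U> where \<U>: "finite \<U>" "\<U> \<subseteq> (\<lambda>x. mball x (e/2)) ` M" "topspace P \<subseteq> \<Union>\<U>"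
    using P(1) unfolding compact_space_alt by meson
  then have "finite_open_cover P \<U>"
    unfolding finite_open_cover_def by (auto simp: PM subset_iff image_iff)
  then obtain \<V> where \<V>: "finite_open_cover P \<V>" "\<And>V. V\<in>\<V> \<Longrightarrow> \<exists>U\<in>\<U>. V \<subseteq> U"
    "\<And>p. p \<in> M \<Longrightarrow> card {V\<in>\<V>. p \<in> V} \<le> k"
    using k top by metis
  have small: "D p q < e" if V: "V \<in> \<V>" and pq: "p \<in> V" "q \<in> V" for V p q
  proof -
    obtain x where "x \<in> M" "V \<subseteq> mball x (e/2)" using \<V>(2)[OF V] \<U>(2) by blast
    then have "D x p < e/2" "D x q < e/2" "p \<in> M" "q \<in> M" "x \<in> M" using pq by auto
    then show ?thesis using triangle[of p x q] commute[of p x] by simp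
  qed
  \<comment> \<open>the distance to the complement of \<open>V\<close>, cut off at \<open>1\<close> since that complement may be empty\<close>
  define u where "u V p = (INF t \<in> insert 1 (D p ` (M - V)). t)" for V p
  have bdd: "bdd_below (insert 1 (D p ` (M - V)))" for V p
    by (rule bdd_belowI[of _ 0]) auto
  have u_le: "u V p \<le> D p q" if "q \<in> M - V" for V p q
    unfolding u_def by (rule cINF_lower2[OF _ _ order_refl]) (use bdd that in auto)
  have u_le1: "u V p \<le> 1" for V p
    unfolding u_def by (rule cINF_lower2[OF _ _ order_refl]) (use bdd in auto)
  have u_ge: "u V p \<ge> c" if "c \<le> 1" "\<And>q. q \<in> M - V \<Longrightarrow> c \<le> D p q" for V p c
    unfolding u_def by (rule cINF_greatest) (use that in auto)
  \<comment> \<open>\<open>u V\<close> is 1-Lipschitz, as an infimum of the constant 1 and of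
    distance functions; this gives its continuity.\<close>
  have u_Lip: "u V p - D p q \<le> u V q" if "p \<in> M" "q \<in> M" for V p q
  proof (rule u_ge)
    show "u V p - D p q \<le> 1" using u_le1[of V p] nonneg[of p q] by linarith
    show "u V p - D p q \<le> D q z" if z: "z \<in> M - V" for z
      using u_le[OF z, of p] triangle[of p q z] z \<open>p \<in> M\<close> \<open>q \<in> M\<close> by auto
  qed
  have u0: "u V p \<noteq> 0 \<longleftrightarrow> p \<in> V" if V: "V \<in> \<V>" and p: "p \<in> M" for V p
  proof
    assume "p \<in> V"
    moreover have "openin mtopology V" using \<V>(1) V by (auto simp: finite_open_cover_def PM)
    ultimately obtain r where r: "r > 0" "mball p r \<subseteq> V" unfolding openin_mtopology by blast
    have "min 1 r \<le> u V p"
      by (rule u_ge) (use r p in \<open>auto simp: subset_iff not_less[symmetric]\<close>)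
    then show "u V p \<noteq> 0" using r by auto
  next
    assume *: "u V p \<noteq> 0"
    show "p \<in> V"
    proof (rule ccontr)
      assume "p \<notin> V"
      then have "u V p \<le> 0" using u_le[of p V p] p by simp
      moreover have "u V p \<ge> 0" by (rule u_ge) auto
      ultimately show False using * by simp
    qed
  qed
  have u_cont: "continuous_map P euclideanreal (u V)" for V
    unfolding PM mtopology_is_euclidean[symmetric]
  proof (subst metric_continuous_map[OF Met_TC.Metric_space_axioms], intro conjI ballI allI impI)
    fix p and \<epsilon> :: real assume p: "p \<in> M" "\<epsilon> > 0"
    have "dist (u V p) (u V q) < \<epsilon>" if "q \<in> M" "D p q < \<epsilon>" for q
      using u_Lip[OF p(1) that(1), of V] u_Lip[OF that(1) p(1), of V] that commute[of p q]
      by (auto simp: dist_real_def abs_less_iff)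
    then show "\<exists>\<delta>>0. \<forall>q. q \<in> M \<and> D p q < \<delta> \<longrightarrow> dist (u V p) (u V q) < \<epsilon>" using p by blast
  qed auto
  have card: "card {V\<in>\<V>. u V (f a) \<noteq> 0} \<le> k" if a: "a \<in> topspace T" for a
  proof -
    have "{V\<in>\<V>. u V (f a) \<noteq> 0} = {V\<in>\<V>. f a \<in> V}" using u0 fM[OF a] by auto
    then show ?thesis using \<V>(3) fM[OF a] by simp
  qed
  \<comment> \<open>If all functions agreed at \<open>a\<close> and \<open>a'\<close>, a member
    containing \<open>f a\<close> would also contain \<open>f a'\<close>, against their distance of
    at least \<open>e\<close>.\<close>
  have sepB: "\<exists>V\<in>\<V>. u V (f a) \<noteq> u V (f a')" if a: "(a, a') \<in> B" for a a'
  proof (rule ccontr)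
    assume n: "\<not> ?thesis"
    have M: "f a \<in> M" "f a' \<in> M" using BT[OF a] fM by auto
    then obtain V where V: "V \<in> \<V>" "f a \<in> V"
      using \<V>(1) by (auto simp: finite_open_cover_def top)
    then have "f a' \<in> V" using u0 n M by metis
    then show False using small[OF V(1) V(2)] e(2)[OF a] by fastforce
  qed
  show thesis
  proof (rule that[of \<V> "\<lambda>V a. u V (f a)"])
    show "finite \<V>" using \<V> by (simp add: finite_open_cover_def)
    show "\<forall>V\<in>\<V>. continuous_map T euclideanreal (\<lambda>a. u V (f a))"
      using continuous_map_compose[OF f u_cont] by (simp add: o_def)
  qed (use card sepB in auto)
qed

subsection \<open>Continuous pseudometrics and widths\<close>


lemma continuous_map_pseudometric:
  assumes "continuous_pseudometric X \<rho>" "continuous_map T X f" "continuous_map T X g"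
  shows "continuous_map T euclideanreal (\<lambda>t. \<rho> (f t) (g t))"
proof -
  have "continuous_map T (prod_topology X X) (\<lambda>t. (f t, g t))"
    using assms by (simp add: continuous_map_paired)
  moreover have "continuous_map (prod_topology X X) euclideanreal (\<lambda>(x, y). \<rho> x y)"
    using assms(1) by (simp add: continuous_pseudometric_def)
  ultimately show ?thesis using continuous_map_compose by (fastforce simp: o_def)
qed

lemma continuous_pseudometric_pullback:
  assumes \<rho>: "continuous_pseudometric Y \<rho>" and \<pi>: "continuous_map X Y \<pi>"
  shows "continuous_pseudometric X (\<lambda>x x'. \<rho> (\<pi> x) (\<pi> x'))"
proof -
  have "\<pi> x \<in> topspace Y" if "x \<in> topspace X" for x
    using continuous_map_funspace[OF \<pi>] that by auto
  moreover have "continuous_map (prod_topology X X) euclideanreal (\<lambda>p. \<rho> (\<pi> (fst p)) (\<pi> (snd p)))"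
    using continuous_map_compose[OF continuous_map_fst \<pi>] continuous_map_compose[OF continuous_map_snd \<pi>]
    by (intro continuous_map_pseudometric[OF \<rho>]) (auto simp: o_def)
  ultimately show ?thesis
    using \<rho> unfolding continuous_pseudometric_def by (simp add: case_prod_unfold)
qed

lemma continuous_pseudometric_add:
  assumes "continuous_pseudometric X \<rho>" "continuous_pseudometric X \<rho>'"
  shows "continuous_pseudometric X (\<lambda>x x'. \<rho> x x' + \<rho>' x x')"
proof -
  have "continuous_map (prod_topology X X) euclideanreal (\<lambda>p. \<rho> (fst p) (snd p) + \<rho>' (fst p) (snd p))"
    using assms by (intro continuous_map_add continuous_map_pseudometric)
      (auto intro: continuous_map_fst continuous_map_snd)
  moreover have "\<rho> x z + \<rho>' x z \<le> \<rho> x y + \<rho>' x y + (\<rho> y z + \<rho>' y z)"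
    if "x \<in> topspace X" "y \<in> topspace X" "z \<in> topspace X" for x y z
  proof -
    have "\<rho> x z \<le> \<rho> x y + \<rho> y z" "\<rho>' x z \<le> \<rho>' x y + \<rho>' y z"
      using assms that by (auto simp: continuous_pseudometric_def)
    then show ?thesis by simp
  qed
  ultimately show ?thesis
    using assms unfolding continuous_pseudometric_def by (simp add: case_prod_unfold)
qed

text \<open>Each condition is the preimage of a closed half-line under a continuous function. As
  \<open>\<sigma> s\<close> permutes \<open>{1..d}\<close>, \<open>\<phi> (\<sigma> s v)\<close> is
  a coordinate of the product and so depends continuously on \<open>\<phi>\<close>.\<close>

lemma closedin_Map_sofic:
  assumes \<rho>: "continuous_pseudometric X \<rho>" and "F \<noteq> {}"
    and \<alpha>: "\<And>s. s \<in> F \<Longrightarrow> continuous_map X X (\<alpha> s)"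
    and \<sigma>: "\<And>s. s \<in> F \<Longrightarrow> \<sigma> s permutes {1..d}"
  shows "closedin (product_topology (\<lambda>_. X) {1..d}) (Map_sofic X \<alpha> \<rho> F \<delta> d \<sigma>)"
proof -
  let ?T = "product_topology (\<lambda>_. X) {1..d}"
  let ?C = "\<lambda>s. {\<phi> \<in> topspace ?T. rho_2 d \<rho> (\<lambda>v. \<alpha> s (\<phi> v)) (\<phi> \<circ> \<sigma> s) \<in> {..\<delta>}}"
  have "closedin ?T (?C s)" if s: "s \<in> F" for s
  proof (rule closedin_continuous_map_preimage)
    have "continuous_map ?T euclideanreal (\<lambda>\<phi>. \<rho> (\<alpha> s (\<phi> v)) (\<phi> (\<sigma> s v)))" if "v \<in> {1..d}" for v
    proof (rule continuous_map_pseudometric[OF \<rho>])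
      show "continuous_map ?T X (\<lambda>\<phi>. \<alpha> s (\<phi> v))"
        using continuous_map_compose[OF continuous_map_product_projection[OF that] \<alpha>[OF s]]
        by (simp add: o_def)
      show "continuous_map ?T X (\<lambda>\<phi>. \<phi> (\<sigma> s v))"
        by (rule continuous_map_product_projection) (use permutes_in_image[OF \<sigma>[OF s]] that in blast)
    qed
    then have "continuous_map ?T euclideanreal
        (\<lambda>\<phi>. 1 / real d * (\<Sum>v\<in>{1..d}. (\<rho> (\<alpha> s (\<phi> v)) (\<phi> (\<sigma> s v)))\<^sup>2))"
      by (intro continuous_map_real_mult continuous_map_sum continuous_map_real_pow) auto
    from continuous_map_sqrt[OF this]
    show "continuous_map ?T euclideanreal (\<lambda>\<phi>. rho_2 d \<rho> (\<lambda>v. \<alpha> s (\<phi> v)) (\<phi> \<circ> \<sigma> s))"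
      by (simp add: o_def rho_2_def)
  qed simp
  moreover have "Map_sofic X \<alpha> \<rho> F \<delta> d \<sigma> = (\<Inter>s\<in>F. ?C s)"
    using \<open>F \<noteq> {}\<close> by (auto simp: Map_sofic_def)
  ultimately show ?thesis using \<open>F \<noteq> {}\<close> by (simp add: closedin_INT)
qed

section \<open>Widths in terms of sparse functions\<close>

lemma rho_inf_less_iff: "d > 0 \<Longrightarrow> rho_inf d \<rho> \<phi> \<psi> < \<epsilon> \<longleftrightarrow> (\<forall>v\<in>{1..d}. \<rho> (\<phi> v) (\<psi> v) < \<epsilon>)"
  unfolding rho_inf_def by (subst Max_less_iff) auto

lemma rho_inf_le_iff: "d > 0 \<Longrightarrow> rho_inf d \<rho> \<phi> \<psi> \<le> \<epsilon> \<longleftrightarrow> (\<forall>v\<in>{1..d}. \<rho> (\<phi> v) (\<psi> v) \<le> \<epsilon>)"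
  unfolding rho_inf_def by (subst Max_le_iff) auto

text \<open>Turns every later upper bound on \<open>Wdim\<close> into a count of nonzero
  functions.\<close>

lemma sparse_functions_imp_Wdim_le:
  fixes g :: "'j \<Rightarrow> (nat \<Rightarrow> 'x) \<Rightarrow> real"
  assumes K: "compactin (product_topology (\<lambda>_. X) {1..d}) K" and J: "finite J"
    and cont: "\<And>j. j \<in> J \<Longrightarrow>
        continuous_map (subtopology (product_topology (\<lambda>_. X) {1..d}) K) euclideanreal (g j)"
    and card: "\<And>\<phi>. \<phi> \<in> K \<Longrightarrow> card {j\<in>J. g j \<phi> \<noteq> 0} \<le> r"
    and sep: "\<And>\<phi> \<phi>'. \<phi> \<in> K \<Longrightarrow> \<phi>' \<in> K \<Longrightarrow> \<forall>j\<in>J. g j \<phi> = g j \<phi>' \<Longrightarrow>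
        rho_inf d \<rho>Y (\<pi> \<circ> \<phi>) (\<pi> \<circ> \<phi>') \<le> \<theta> \<Longrightarrow> rho_inf d \<rho>X \<phi> \<phi>' < \<epsilon>"
  shows "Wdim X \<pi> d \<epsilon> K \<theta> \<rho>X \<rho>Y \<le> ereal (real r)"
proof -
  let ?T = "subtopology (product_topology (\<lambda>_. X) {1..d}) K"
  have K': "topspace ?T = K" using compactin_subset_topspace[OF K] by auto
  have card': "card {j\<in>J. g j \<phi> \<noteq> 0} \<le> r" if "\<phi> \<in> topspace ?T" for \<phi>
    using card that unfolding K' by blast
  obtain P :: "(nat \<Rightarrow> real) topology" and f
    where P: "compact_space P" "metrizable_space P" "covering_dim P \<le> ereal (real r)"
    and f: "continuous_map ?T P f" "\<forall>\<phi> \<phi>'. f \<phi> = f \<phi>' \<longrightarrow> (\<forall>j\<in>J. g j \<phi> = g j \<phi>')"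
    by (rule sparse_functions_imp_covering_dim_le[OF compact_space_subtopology[OF K] J cont card'])
  have "Wdim X \<pi> d \<epsilon> K \<theta> \<rho>X \<rho>Y \<le> covering_dim P"
    unfolding Wdim_def
  proof (rule INF_lower, intro CollectI conjI exI ballI impI; (elim conjE)?)
    fix \<phi> \<phi>' assume "\<phi> \<in> K" "\<phi>' \<in> K" "f \<phi> = f \<phi>'" "rho_inf d \<rho>Y (\<pi> \<circ> \<phi>) (\<pi> \<circ> \<phi>') \<le> \<theta>"
    then show "rho_inf d \<rho>X \<phi> \<phi>' < \<epsilon>" using sep f(2) by blast
  qed (use P f in auto)
  then show ?thesis using P(3) by simp
qed

text \<open>Converse of the preceding bound. A dimension below \<open>c\<close> comes from a
  multiplicity \<open>k\<close> with \<open>k - 1 < c\<close>, while \<open>k\<close> nonzero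
  functions only bound the dimension by \<open>k\<close>: the round trip costs 1.\<close>

lemma Wdim_less_imp_sparse_functions:
  assumes \<rho>X: "continuous_pseudometric X \<rho>X" and \<rho>Y: "continuous_pseudometric Y \<rho>Y"
    and \<pi>: "continuous_map X Y \<pi>" and "d > 0"
    and K: "compactin (product_topology (\<lambda>_. X) {1..d}) K"
    and W: "Wdim X \<pi> d \<epsilon> K \<theta> \<rho>X \<rho>Y < ereal c"
  obtains k :: nat and J :: "(nat \<Rightarrow> real) set set" and g where "real k - 1 < c" "finite J"
    "\<forall>j\<in>J. continuous_map (subtopology (product_topology (\<lambda>_. X) {1..d}) K) euclideanreal (g j)"
    "\<forall>\<phi>\<in>K. card {j\<in>J. g j \<phi> \<noteq> 0} \<le> k"
    "\<forall>\<phi>\<in>K. \<forall>\<phi>'\<in>K. (\<forall>j\<in>J. g j \<phi> = g j \<phi>') \<longrightarrow>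
        rho_inf d \<rho>Y (\<pi> \<circ> \<phi>) (\<pi> \<circ> \<phi>') \<le> \<theta> \<longrightarrow> rho_inf d \<rho>X \<phi> \<phi>' < \<epsilon>"
proof -
  define T where "T = subtopology (product_topology (\<lambda>_. X) {1..d}) K"
  have K': "topspace T = K" using compactin_subset_topspace[OF K] by (auto simp: T_def)
  obtain P :: "(nat \<Rightarrow> real) topology" and f where P: "compact_space P" "metrizable_space P"
    and f: "continuous_map T P f"
    and sep: "\<And>\<phi> \<phi>'. \<phi> \<in> K \<Longrightarrow> \<phi>' \<in> K \<Longrightarrow> f \<phi> = f \<phi>' \<Longrightarrow> rho_inf d \<rho>Y (\<pi> \<circ> \<phi>) (\<pi> \<circ> \<phi>') \<le> \<theta> \<Longrightarrow>
        rho_inf d \<rho>X \<phi> \<phi>' < \<epsilon>"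
    and dim: "covering_dim P < ereal c"
    using W unfolding Wdim_def INF_less_iff T_def[symmetric] by blast
  obtain k :: nat where k: "\<And>\<U>. finite_open_cover P \<U> \<Longrightarrow>
              \<exists>\<V>. finite_open_cover P \<V> \<and> (\<forall>V\<in>\<V>. \<exists>U\<in>\<U>. V \<subseteq> U) \<and>
                  (\<forall>p\<in>topspace P. card {V\<in>\<V>. p \<in> V} \<le> k)" and kc: "real k - 1 < c"
    using dim unfolding covering_dim_def INF_less_iff by auto
  define Q where "Q = prod_topology T T"
  define A where "A v = {p \<in> topspace Q. \<rho>Y (\<pi> (fst p v)) (\<pi> (snd p v)) \<in> {..\<theta>}}" for v
  define C where "C v = {p \<in> topspace Q. \<rho>X (fst p v) (snd p v) \<in> {\<epsilon>..}}" for v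
  \<comment> \<open>The pairs that every admissible map has to separate: within
    \<open>\<theta>\<close> for \<open>\<rho>Y\<close> at all coordinates, but at distance at least
    \<open>\<epsilon>\<close> for \<open>\<rho>X\<close> at some coordinate. These are closed
    conditions, so \<open>B\<close> is compact.\<close>
  define B where "B = (\<Inter>v\<in>{1..d}. A v) \<inter> (\<Union>v\<in>{1..d}. C v)"
  have proj: "continuous_map Q X (\<lambda>p. fst p v)" "continuous_map Q X (\<lambda>p. snd p v)" if "v \<in> {1..d}" for v
  proof -
    have *: "continuous_map T X (\<lambda>\<phi>. \<phi> v)" unfolding T_def
      by (intro continuous_map_from_subtopology continuous_map_product_projection that)
    show "continuous_map Q X (\<lambda>p. fst p v)" "continuous_map Q X (\<lambda>p. snd p v)"
      using continuous_map_compose[OF continuous_map_fst *] continuous_map_compose[OF continuous_map_snd *]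
      by (auto simp: o_def Q_def)
  qed
  have "closedin Q (A v)" "closedin Q (C v)" if v: "v \<in> {1..d}" for v
    unfolding A_def C_def
    by (rule closedin_continuous_map_preimage
          [OF continuous_map_pseudometric[OF continuous_pseudometric_pullback[OF \<rho>Y \<pi>] proj[OF v]]], simp)
      (rule closedin_continuous_map_preimage[OF continuous_map_pseudometric[OF \<rho>X proj[OF v]]], simp)
  then have "closedin Q B"
    unfolding B_def using \<open>d > 0\<close> by (intro closedin_Int closedin_INT closedin_Union) auto
  moreover have "compact_space Q"
    using compact_space_subtopology[OF K] unfolding Q_def T_def compact_space_prod_topology by blast
  ultimately have cB: "compactin (prod_topology T T) B" by (simp add: closedin_compact_space Q_def)
  have Biff: "(\<phi>, \<phi>') \<in> B \<longleftrightarrow> \<phi> \<in> K \<and> \<phi>' \<in> K \<and> rho_inf d \<rho>Y (\<pi> \<circ> \<phi>) (\<pi> \<circ> \<phi>') \<le> \<theta> \<and>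
      \<not> rho_inf d \<rho>X \<phi> \<phi>' < \<epsilon>" for \<phi> \<phi>'
    using \<open>d > 0\<close> by (auto simp: B_def A_def C_def Q_def K' rho_inf_less_iff rho_inf_le_iff not_less Suc_le_eq)
  have sepB: "f \<phi> \<noteq> f \<phi>'" if "(\<phi>, \<phi>') \<in> B" for \<phi> \<phi>'
    using sep that unfolding Biff by blast
  obtain J :: "(nat \<Rightarrow> real) set set" and g where J: "finite J"
    "\<forall>j\<in>J. continuous_map T euclideanreal (g j)"
    "\<forall>a\<in>topspace T. card {j\<in>J. g j a \<noteq> 0} \<le> k"
    "\<forall>(a, a')\<in>B. \<exists>j\<in>J. g j a \<noteq> g j a'"
    by (rule refinement_imp_sparse_functions[OF P f k cB sepB])
  show thesis
  proof (rule that[OF kc J(1), of g])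
    show "\<forall>\<phi>\<in>K. \<forall>\<phi>'\<in>K. (\<forall>j\<in>J. g j \<phi> = g j \<phi>') \<longrightarrow>
        rho_inf d \<rho>Y (\<pi> \<circ> \<phi>) (\<pi> \<circ> \<phi>') \<le> \<theta> \<longrightarrow> rho_inf d \<rho>X \<phi> \<phi>' < \<epsilon>"
      using J(4) Biff by blast
    show "\<forall>j\<in>J. continuous_map (subtopology (product_topology (\<lambda>_. X) {1..d}) K) euclideanreal (g j)"
      using J(2) unfolding T_def .
    show "\<forall>\<phi>\<in>K. card {j\<in>J. g j \<phi> \<noteq> 0} \<le> k" using J(3) unfolding K' .
  qed
qed


text \<open>The functions \<open>l v\<close> mark the exceptional coordinates. If the products \<open>l v \<phi> * max 0 (r - \<tau> (\<phi> v) c)\<close>,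
  \<open>c \<in> C\<close>, agree at \<open>\<phi>\<close> and \<open>\<phi>'\<close> and \<open>v\<close> is exceptional for one of them, then \<open>\<phi> v\<close> and \<open>\<phi>' v\<close> are
  both \<open>r\<close>-close to the same \<open>c\<close>.\<close>

lemma Wdim_le_Wdim_add:
  fixes l :: "nat \<Rightarrow> (nat \<Rightarrow> 'x) \<Rightarrow> real"
  assumes \<rho>X2: "continuous_pseudometric X \<rho>X2" and \<rho>Y2: "continuous_pseudometric Y \<rho>Y2"
    and \<tau>: "continuous_pseudometric X \<tau>" and \<pi>: "continuous_map X Y \<pi>" and "d > 0"
    and K1: "compactin (product_topology (\<lambda>_. X) {1..d}) K1"
    and K2: "compactin (product_topology (\<lambda>_. X) {1..d}) K2" and "K1 \<subseteq> K2"
    and C: "finite C" "C \<subseteq> topspace X" "\<And>x. x \<in> topspace X \<Longrightarrow> \<exists>c\<in>C. \<tau> x c < r"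
    and near: "\<And>x x'. x \<in> topspace X \<Longrightarrow> x' \<in> topspace X \<Longrightarrow> \<tau> x x' < 2 * r \<Longrightarrow>
        \<rho>X1 x x' < \<epsilon>1 \<and> \<rho>Y2 (\<pi> x) (\<pi> x') \<le> \<theta>2"
    and l: "\<And>v. v \<in> {1..d} \<Longrightarrow> continuous_map (product_topology (\<lambda>_. X) {1..d}) euclideanreal (l v)"
    and l_nonneg: "\<And>v \<phi>. l v \<phi> \<ge> 0"
    and l_card: "\<And>\<phi>. \<phi> \<in> K1 \<Longrightarrow> card {v\<in>{1..d}. l v \<phi> \<noteq> 0} \<le> m"
    and good1: "\<And>\<phi> \<phi>' v. \<phi> \<in> K1 \<Longrightarrow> \<phi>' \<in> K1 \<Longrightarrow> v \<in> {1..d} \<Longrightarrow> l v \<phi> = 0 \<Longrightarrow> l v \<phi>' = 0 \<Longrightarrow>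
        rho_inf d \<rho>X2 \<phi> \<phi>' < \<epsilon>2 \<Longrightarrow> \<rho>X1 (\<phi> v) (\<phi>' v) < \<epsilon>1"
    and good2: "\<And>\<phi> \<phi>' v. \<phi> \<in> K1 \<Longrightarrow> \<phi>' \<in> K1 \<Longrightarrow> v \<in> {1..d} \<Longrightarrow> l v \<phi> = 0 \<Longrightarrow> l v \<phi>' = 0 \<Longrightarrow>
        rho_inf d \<rho>Y1 (\<pi> \<circ> \<phi>) (\<pi> \<circ> \<phi>') \<le> \<theta>1 \<Longrightarrow> \<rho>Y2 (\<pi> (\<phi> v)) (\<pi> (\<phi>' v)) \<le> \<theta>2"
  shows "Wdim X \<pi> d \<epsilon>1 K1 \<theta>1 \<rho>X1 \<rho>Y1 \<le> Wdim X \<pi> d \<epsilon>2 K2 \<theta>2 \<rho>X2 \<rho>Y2 + ereal (real (m * card C) + 1)"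
proof -
  define b where "b = real (m * card C) + 1"
  define W1 where "W1 = Wdim X \<pi> d \<epsilon>1 K1 \<theta>1 \<rho>X1 \<rho>Y1"
  \<comment> \<open>\<open>Wdim\<close> is an infimum and may be infinite, so the bound is proved
    for each real \<open>c\<close> above it and the limit is taken at the end.\<close>
  have main: "W1 \<le> ereal (c + b)" if c: "Wdim X \<pi> d \<epsilon>2 K2 \<theta>2 \<rho>X2 \<rho>Y2 < ereal c" for c
  proof -
    obtain k :: nat and J :: "(nat \<Rightarrow> real) set set" and g where k: "real k - 1 < c" and J: "finite J"
      and gcont: "\<forall>j\<in>J. continuous_map (subtopology (product_topology (\<lambda>_. X) {1..d}) K2) euclideanreal (g j)"
      and gcard: "\<forall>\<phi>\<in>K2. card {j\<in>J. g j \<phi> \<noteq> 0} \<le> k"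
      and gsep: "\<forall>\<phi>\<in>K2. \<forall>\<phi>'\<in>K2. (\<forall>j\<in>J. g j \<phi> = g j \<phi>') \<longrightarrow>
        rho_inf d \<rho>Y2 (\<pi> \<circ> \<phi>) (\<pi> \<circ> \<phi>') \<le> \<theta>2 \<longrightarrow> rho_inf d \<rho>X2 \<phi> \<phi>' < \<epsilon>2"
      by (rule Wdim_less_imp_sparse_functions[OF \<rho>X2 \<rho>Y2 \<pi> \<open>d > 0\<close> K2 c])
    define h where "h v q \<phi> = l v \<phi> * max 0 (r - \<tau> (\<phi> v) q)" for v q and \<phi> :: "nat \<Rightarrow> 'x"
    define G where "G = case_sum g (\<lambda>(v, q). h v q)"
    define I where "I = J <+> ({1..d} \<times> C)"
    have top: "\<phi> v \<in> topspace X" if "\<phi> \<in> K1" "v \<in> {1..d}" for \<phi> v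
      using compactin_subset_topspace[OF K1] that by (auto simp: PiE_iff)
    have "W1 \<le> ereal (real (k + m * card C))"
      unfolding W1_def
    proof (rule sparse_functions_imp_Wdim_le[where J = I and g = G, OF K1])
      show "finite I" using J C by (simp add: I_def)
      show "continuous_map (subtopology (product_topology (\<lambda>_. X) {1..d}) K1) euclideanreal (G i)"
        if i: "i \<in> I" for i
      proof (cases i)
        case (Inl j)
        then have "j \<in> J" using i by (auto simp: I_def)
        then show ?thesis
          using continuous_map_from_subtopology_mono[OF bspec[OF gcont] \<open>K1 \<subseteq> K2\<close>] Inl
          by (simp add: G_def)
      next
        case (Inr p)
        obtain v q where p: "p = (v, q)" by force
        then have v: "v \<in> {1..d}" and q: "q \<in> C" using i Inr by (auto simp: I_def)
        have "continuous_map (product_topology (\<lambda>_. X) {1..d}) euclideanreal (\<lambda>\<phi>. \<tau> (\<phi> v) q)"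
          by (rule continuous_map_pseudometric[OF \<tau> continuous_map_product_projection[OF v]])
            (use q C in auto)
        then have "continuous_map (product_topology (\<lambda>_. X) {1..d}) euclideanreal (h v q)"
          unfolding h_def using l[OF v]
          by (intro continuous_map_real_mult continuous_map_real_max continuous_map_diff) auto
        then show ?thesis
          using Inr p by (simp add: G_def continuous_map_from_subtopology)
      qed
      show "card {i\<in>I. G i \<phi> \<noteq> 0} \<le> k + m * card C" if \<phi>: "\<phi> \<in> K1" for \<phi>
      proof -
        \<comment> \<open>The product \<open>h v q\<close> vanishes unless \<open>v\<close> is
          exceptional, so at most \<open>m * card C\<close> of the products are nonzero.\<close>
        have "{i\<in>I. G i \<phi> \<noteq> 0} \<subseteq> {j\<in>J. g j \<phi> \<noteq> 0} <+> ({v\<in>{1..d}. l v \<phi> \<noteq> 0} \<times> C)"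
          by (auto simp: I_def G_def h_def)
        then have "card {i\<in>I. G i \<phi> \<noteq> 0} \<le> card ({j\<in>J. g j \<phi> \<noteq> 0} <+> ({v\<in>{1..d}. l v \<phi> \<noteq> 0} \<times> C))"
          by (intro card_mono) (use J C in auto)
        also have "\<dots> = card {j\<in>J. g j \<phi> \<noteq> 0} + card {v\<in>{1..d}. l v \<phi> \<noteq> 0} * card C"
          using J C by (simp add: card_Plus card_cartesian_product)
        also have "\<dots> \<le> k + m * card C"
          using gcard l_card[OF \<phi>] \<phi> \<open>K1 \<subseteq> K2\<close> by (intro add_mono mult_right_mono) auto
        finally show ?thesis .
      qed
      fix \<phi> \<phi>' assume \<phi>: "\<phi> \<in> K1" "\<phi>' \<in> K1" and eq: "\<forall>i\<in>I. G i \<phi> = G i \<phi>'"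
        and Y1: "rho_inf d \<rho>Y1 (\<pi> \<circ> \<phi>) (\<pi> \<circ> \<phi>') \<le> \<theta>1"
      have geq: "g j \<phi> = g j \<phi>'" if "j \<in> J" for j
      proof -
        have "Inl j \<in> I" using that unfolding I_def by blast
        then have "G (Inl j) \<phi> = G (Inl j) \<phi>'" using eq by blast
        then show ?thesis by (simp add: G_def)
      qed
      have heq: "h v q \<phi> = h v q \<phi>'" if "v \<in> {1..d}" "q \<in> C" for v q
      proof -
        have "Inr (v, q) \<in> I" using that unfolding I_def by blast
        then have "G (Inr (v, q)) \<phi> = G (Inr (v, q)) \<phi>'" using eq by blast
        then show ?thesis by (simp add: G_def)
      qed
      have bad: "\<tau> (\<phi> v) (\<phi>' v) < 2 * r" if v: "v \<in> {1..d}" and "\<not> (l v \<phi> = 0 \<and> l v \<phi>' = 0)" for v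
      proof -
        have close: "\<tau> (\<phi>1 v) (\<phi>2 v) < 2 * r"
          if n: "l v \<phi>1 \<noteq> 0" and \<phi>12: "\<phi>1 \<in> K1" "\<phi>2 \<in> K1" and e: "\<And>q. q \<in> C \<Longrightarrow> h v q \<phi>1 = h v q \<phi>2"
          for \<phi>1 \<phi>2
        proof -
          obtain q where q: "q \<in> C" "\<tau> (\<phi>1 v) q < r" using C(3) top[OF \<phi>12(1) v] by blast
          then have "h v q \<phi>1 \<noteq> 0" using n by (simp add: h_def)
          then have "h v q \<phi>2 \<noteq> 0" using e q by simp
          then have "\<tau> (\<phi>2 v) q < r" by (simp add: h_def max_def split: if_splits)
          moreover have "q \<in> topspace X" using q C by auto
          ultimately show ?thesis
            using q(2) \<tau> top[OF \<phi>12(1) v] top[OF \<phi>12(2) v] unfolding continuous_pseudometric_def by smt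
        qed
        have sym: "\<tau> (\<phi> v) (\<phi>' v) = \<tau> (\<phi>' v) (\<phi> v)"
          using \<tau> top[OF \<phi>(1) v] top[OF \<phi>(2) v] by (simp add: continuous_pseudometric_def)
        show ?thesis
          using close[OF _ \<phi>] close[OF _ \<phi>(2,1)] heq[OF v] that(2) sym by metis
      qed
      \<comment> \<open>Order of deduction: closeness for \<open>\<rho>Y1\<close> gives closeness
        for \<open>\<rho>Y2\<close> at every coordinate; only then do the functions \<open>g\<close>
        yield closeness for \<open>\<rho>X2\<close>, which in turn gives it for
        \<open>\<rho>X1\<close>.\<close>
      have "rho_inf d \<rho>Y2 (\<pi> \<circ> \<phi>) (\<pi> \<circ> \<phi>') \<le> \<theta>2"
        unfolding rho_inf_le_iff[OF \<open>d > 0\<close>]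
      proof
        fix v assume v: "v \<in> {1..d}"
        show "\<rho>Y2 ((\<pi> \<circ> \<phi>) v) ((\<pi> \<circ> \<phi>') v) \<le> \<theta>2"
        proof (cases "l v \<phi> = 0 \<and> l v \<phi>' = 0")
          case True then show ?thesis using good2[OF \<phi> v _ _ Y1] by simp
        next
          case False then show ?thesis using near top[OF \<phi>(1) v] top[OF \<phi>(2) v] bad[OF v] by simp
        qed
      qed
      then have X2: "rho_inf d \<rho>X2 \<phi> \<phi>' < \<epsilon>2"
        using gsep geq \<phi> \<open>K1 \<subseteq> K2\<close> by blast
      show "rho_inf d \<rho>X1 \<phi> \<phi>' < \<epsilon>1"
        unfolding rho_inf_less_iff[OF \<open>d > 0\<close>]
      proof
        fix v assume v: "v \<in> {1..d}"
        show "\<rho>X1 (\<phi> v) (\<phi>' v) < \<epsilon>1"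
        proof (cases "l v \<phi> = 0 \<and> l v \<phi>' = 0")
          case True then show ?thesis using good1[OF \<phi> v _ _ X2] by simp
        next
          case False then show ?thesis using near top[OF \<phi>(1) v] top[OF \<phi>(2) v] bad[OF v] by simp
        qed
      qed
    qed
    \<comment> \<open>The 1 in \<open>b\<close> pays for \<open>k < c + 1\<close>.\<close>
    also have "\<dots> \<le> ereal (c + b)" using k by (simp add: b_def)
    finally show ?thesis .
  qed
  have "W1 - ereal b \<le> Wdim X \<pi> d \<epsilon>2 K2 \<theta>2 \<rho>X2 \<rho>Y2"
  proof (rule dense_ge)
    fix x assume x: "Wdim X \<pi> d \<epsilon>2 K2 \<theta>2 \<rho>X2 \<rho>Y2 < x"
    show "W1 - ereal b \<le> x"
    proof (cases x)
      case (real c)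
      then show ?thesis using main[of c] x by (simp add: ereal_minus_le)
    qed (use x in auto)
  qed
  then show ?thesis unfolding W1_def b_def by (simp add: ereal_minus_le)
qed

subsection \<open>Generating pseudometrics and almost equivariant maps\<close>


lemma rho_2_chebyshev:
  assumes "rho_2 d \<rho> \<phi> \<psi> \<le> \<delta>" "d > 0" "\<kappa> > 0"
  shows "real (card {v\<in>{1..d}. \<kappa> \<le> \<rho> (\<phi> v) (\<psi> v)}) \<le> (\<delta> / \<kappa>)\<^sup>2 * real d"
proof -
  let ?S = "{v\<in>{1..d}. \<kappa> \<le> \<rho> (\<phi> v) (\<psi> v)}" and ?q = "\<lambda>v. (\<rho> (\<phi> v) (\<psi> v))\<^sup>2"
  have "real (card ?S) * \<kappa>\<^sup>2 = (\<Sum>v\<in>?S. \<kappa>\<^sup>2)" by simp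
  also have "\<dots> \<le> (\<Sum>v\<in>?S. ?q v)" using assms by (intro sum_mono power_mono) auto
  also have "\<dots> \<le> (\<Sum>v\<in>{1..d}. ?q v)" by (rule sum_mono2) auto
  also have "\<dots> = real d * (rho_2 d \<rho> \<phi> \<psi>)\<^sup>2"
    using assms by (simp add: rho_2_def sum_nonneg)
  also have "\<dots> \<le> real d * \<delta>\<^sup>2"
    by (intro mult_left_mono power_mono assms) (auto simp: rho_2_def sum_nonneg)
  finally show ?thesis using assms by (simp add: field_simps)
qed

text \<open>Coordinates below \<open>\<kappa>\<close> contribute at most
  \<open>\<kappa>\<^sup>2\<close> to the mean square; the others are a fraction of at most
  \<open>\<eta>\<close> and contribute at most \<open>C\<^sup>2\<close> each.\<close>

lemma rho_2_leI:
  assumes "\<And>v. v \<in> {1..d} \<Longrightarrow> 0 \<le> \<rho> (\<phi> v) (\<psi> v) \<and> \<rho> (\<phi> v) (\<psi> v) \<le> C"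
    and card: "real (card {v\<in>{1..d}. \<kappa> \<le> \<rho> (\<phi> v) (\<psi> v)}) \<le> \<eta> * real d"
    and "\<kappa>\<^sup>2 + C\<^sup>2 * \<eta> \<le> \<delta>\<^sup>2" "d > 0" "\<delta> \<ge> 0"
  shows "rho_2 d \<rho> \<phi> \<psi> \<le> \<delta>"
proof -
  let ?S = "{v\<in>{1..d}. \<kappa> \<le> \<rho> (\<phi> v) (\<psi> v)}" and ?q = "\<lambda>v. (\<rho> (\<phi> v) (\<psi> v))\<^sup>2"
  have "(\<Sum>v\<in>{1..d}. ?q v) \<le> (\<Sum>v\<in>{1..d}. \<kappa>\<^sup>2 + (if v \<in> ?S then C\<^sup>2 else 0))"
  proof (rule sum_mono)
    fix v assume v: "v \<in> {1..d}"
    show "?q v \<le> \<kappa>\<^sup>2 + (if v \<in> ?S then C\<^sup>2 else 0)"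
    proof (cases "v \<in> ?S")
      case True
      have "?q v \<le> C\<^sup>2" using assms(1)[OF v] by (intro power_mono) auto
      also have "C\<^sup>2 \<le> \<kappa>\<^sup>2 + C\<^sup>2" by simp
      finally show ?thesis using True by simp
    next
      case False
      then have "?q v \<le> \<kappa>\<^sup>2" using assms(1)[OF v] v by (intro power_mono) auto
      then show ?thesis by (subst if_not_P[OF False]) simp
    qed
  qed
  also have "\<dots> = real d * \<kappa>\<^sup>2 + real (card ?S) * C\<^sup>2"
    by (simp add: sum.distrib sum.If_cases Int_def)
  also have "\<dots> \<le> real d * \<kappa>\<^sup>2 + \<eta> * real d * C\<^sup>2"
    by (intro add_left_mono mult_right_mono card) auto
  also have "\<dots> = real d * (\<kappa>\<^sup>2 + C\<^sup>2 * \<eta>)" by (simp add: algebra_simps)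
  also have "\<dots> \<le> real d * \<delta>\<^sup>2" using assms by (intro mult_left_mono) auto
  finally have "1 / real d * (\<Sum>v\<in>{1..d}. ?q v) \<le> \<delta>\<^sup>2" using assms by (simp add: field_simps)
  then have "sqrt (1 / real d * (\<Sum>v\<in>{1..d}. ?q v)) \<le> sqrt (\<delta>\<^sup>2)" by (rule real_sqrt_le_mono)
  then show ?thesis using assms by (simp add: rho_2_def)
qed

text \<open>The pairs with \<open>\<tau>\<close> at least \<open>\<kappa>\<close> form a compact set
  off the diagonal. The generating property covers it by the open sets on which some translate of
  \<open>\<rho>\<close> exceeds \<open>1 / (n + 1)\<close>; a finite subcover provides
  \<open>F\<close> and \<open>\<kappa>'\<close>.\<close>

lemma dynamically_generating_controls:
  assumes "group \<Gamma>" and X: "compact_space X"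
    and \<alpha>: "\<And>s. s \<in> carrier \<Gamma> \<Longrightarrow> continuous_map X X (\<alpha> s)"
    and \<rho>: "continuous_pseudometric X \<rho>" and gen: "dynamically_generating \<Gamma> X \<alpha> \<rho>"
    and \<tau>: "continuous_pseudometric X \<tau>" and "\<kappa> > 0"
  obtains F \<kappa>' where "finite F" "F \<noteq> {}" "F \<subseteq> carrier \<Gamma>" "\<kappa>' > (0::real)"
    "\<forall>x\<in>topspace X. \<forall>x'\<in>topspace X. (\<forall>s\<in>F. \<rho> (\<alpha> s x) (\<alpha> s x') < \<kappa>') \<longrightarrow> \<tau> x x' < \<kappa>"
proof -
  interpret group \<Gamma> by fact
  define Q where "Q = prod_topology X X"
  define C where "C = {p \<in> topspace Q. \<tau> (fst p) (snd p) \<in> {\<kappa>..}}"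
  define U where "U = (\<lambda>(s, n). {p \<in> topspace Q. \<rho> (\<alpha> s (fst p)) (\<alpha> s (snd p)) \<in> {inverse (real (Suc n))<..}})"
  have fs: "continuous_map Q X fst" "continuous_map Q X snd"
    by (auto simp: Q_def continuous_map_fst continuous_map_snd)
  have "closedin Q C" unfolding C_def
    by (rule closedin_continuous_map_preimage[OF continuous_map_pseudometric[OF \<tau> fs]]) simp
  moreover have "compact_space Q" using X unfolding Q_def compact_space_prod_topology by blast
  ultimately have C: "compactin Q C" by (simp add: closedin_compact_space)
  have "openin Q V" if V: "V \<in> U ` (carrier \<Gamma> \<times> UNIV)" for V
  proof -
    obtain s n where s: "s \<in> carrier \<Gamma>" and Vs: "V = U (s, n)" using V by blast
    have "continuous_map Q X (\<lambda>p. \<alpha> s (fst p))" "continuous_map Q X (\<lambda>p. \<alpha> s (snd p))"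
      using continuous_map_compose[OF fs(1) \<alpha>[OF s]] continuous_map_compose[OF fs(2) \<alpha>[OF s]]
      by (auto simp: o_def)
    from openin_continuous_map_preimage[OF continuous_map_pseudometric[OF \<rho> this],
        of "{inverse (real (Suc n))<..}"]
    show ?thesis unfolding Vs U_def prod.case by simp
  qed
  moreover have "C \<subseteq> \<Union>(U ` (carrier \<Gamma> \<times> UNIV))"
  proof
    fix p assume p: "p \<in> C"
    obtain x x' where px: "p = (x, x')" by force
    have x: "x \<in> topspace X" "x' \<in> topspace X" "\<kappa> \<le> \<tau> x x'" using p by (auto simp: C_def Q_def px)
    then have "x \<noteq> x'" using \<tau> \<open>\<kappa> > 0\<close> by (auto simp: continuous_pseudometric_def)
    then have "(SUP s\<in>carrier \<Gamma>. \<rho> (\<alpha> s x) (\<alpha> s x')) > 0"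
      using gen x by (auto simp: dynamically_generating_def)
    \<comment> \<open>A supremum over the nonempty group is positive only if some translate
      is.\<close>
    moreover have "(SUP s\<in>carrier \<Gamma>. \<rho> (\<alpha> s x) (\<alpha> s x')) \<le> 0"
      if "\<forall>s\<in>carrier \<Gamma>. \<rho> (\<alpha> s x) (\<alpha> s x') \<le> 0"
      by (rule cSUP_least) (use that one_closed in auto)
    ultimately obtain s where s: "s \<in> carrier \<Gamma>" "\<rho> (\<alpha> s x) (\<alpha> s x') > 0"
      by (meson not_less)
    then obtain n where "inverse (real (Suc n)) < \<rho> (\<alpha> s x) (\<alpha> s x')"
      using reals_Archimedean by blast
    then have "p \<in> U (s, n)" using p by (auto simp: U_def px C_def)
    then show "p \<in> \<Union>(U ` (carrier \<Gamma> \<times> UNIV))" using s by blast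
  qed
  ultimately obtain \<F> where "finite \<F>" "\<F> \<subseteq> U ` (carrier \<Gamma> \<times> UNIV)" "C \<subseteq> \<Union>\<F>"
    using compactinD[OF C] by meson
  then obtain I where I: "finite I" "I \<subseteq> carrier \<Gamma> \<times> UNIV" "C \<subseteq> \<Union>(U ` I)"
    using finite_subset_image[of \<F> U "carrier \<Gamma> \<times> UNIV"] by blast
  \<comment> \<open>The inserted 1, like the group unit inserted into the finite set below, covers
    the case of empty \<open>I\<close>.\<close>
  define \<kappa>' where "\<kappa>' = Min (insert 1 ((\<lambda>i. inverse (real (Suc (snd i)))) ` I))"
  show thesis
  proof (rule that)
    show "finite (insert \<one>\<^bsub>\<Gamma>\<^esub> (fst ` I))" "insert \<one>\<^bsub>\<Gamma>\<^esub> (fst ` I) \<noteq> {}" using I by auto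
    show "insert \<one>\<^bsub>\<Gamma>\<^esub> (fst ` I) \<subseteq> carrier \<Gamma>" using I by auto
    show "\<kappa>' > 0" unfolding \<kappa>'_def using I by (subst Min_gr_iff) auto
    show "\<forall>x\<in>topspace X. \<forall>x'\<in>topspace X.
        (\<forall>s\<in>insert \<one>\<^bsub>\<Gamma>\<^esub> (fst ` I). \<rho> (\<alpha> s x) (\<alpha> s x') < \<kappa>') \<longrightarrow> \<tau> x x' < \<kappa>"
    proof (intro ballI impI, rule ccontr)
      fix x x' assume x: "x \<in> topspace X" "x' \<in> topspace X" "\<not> \<tau> x x' < \<kappa>"
        and small: "\<forall>s\<in>insert \<one>\<^bsub>\<Gamma>\<^esub> (fst ` I). \<rho> (\<alpha> s x) (\<alpha> s x') < \<kappa>'"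
      have "(x, x') \<in> C" using x by (auto simp: C_def Q_def)
      then obtain i where i: "i \<in> I" "(x, x') \<in> U i" using I(3) by blast
      then have "inverse (real (Suc (snd i))) < \<rho> (\<alpha> (fst i) x) (\<alpha> (fst i) x')"
        by (auto simp: U_def case_prod_unfold)
      moreover have "\<rho> (\<alpha> (fst i) x) (\<alpha> (fst i) x') < \<kappa>'" using small i(1) by auto
      moreover have "\<kappa>' \<le> inverse (real (Suc (snd i)))"
        unfolding \<kappa>'_def by (rule Min_le) (use I(1) i(1) in auto)
      ultimately show False by linarith
    qed
  qed
qed

lemma continuous_pseudometric_bounded:
  assumes X: "compact_space X" and \<tau>: "continuous_pseudometric X \<tau>"
  obtains C where "C > 0" "\<forall>x\<in>topspace X. \<forall>x'\<in>topspace X. \<tau> x x' \<le> C"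
proof -
  let ?Q = "prod_topology X X"
  have "compact_space ?Q" using X unfolding compact_space_prod_topology by blast
  then have "compactin ?Q (topspace ?Q)" unfolding compact_space_def .
  then have "compact ((\<lambda>p. \<tau> (fst p) (snd p)) ` topspace ?Q)"
    using image_compactin[OF _ continuous_map_pseudometric[OF \<tau> continuous_map_fst continuous_map_snd]]
    by fastforce
  then obtain C where C: "\<forall>y\<in>(\<lambda>p. \<tau> (fst p) (snd p)) ` topspace ?Q. norm y \<le> C"
    using compact_imp_bounded bounded_iff by metis
  show thesis
  proof (rule that[of "max C 1"])
    show "\<forall>x\<in>topspace X. \<forall>x'\<in>topspace X. \<tau> x x' \<le> max C 1"
    proof (intro ballI)
      fix x x' assume "x \<in> topspace X" "x' \<in> topspace X"
      then have "norm (\<tau> x x') \<le> C" using C by force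
      then show "\<tau> x x' \<le> max C 1" by simp
    qed
  qed simp
qed


section \<open>Almost equivariant maps along a sofic approximation\<close>

lemma sofic_approximation_permutes:
  "sofic_approximation \<Gamma> d \<sigma> \<Longrightarrow> s \<in> carrier \<Gamma> \<Longrightarrow> \<sigma> i s permutes {1..d i}"
  by (simp add: sofic_approximation_def sym_group_def)

lemma sofic_approximation_eventually_ge:
  assumes "sofic_approximation \<Gamma> d \<sigma>"
  shows "\<forall>\<^sub>F i in sequentially. n \<le> d i"
  using assms filterlim_at_top[of d sequentially] unfolding sofic_approximation_def by blast

lemma sofic_approximation_eventually_mult:
  assumes \<sigma>: "sofic_approximation \<Gamma> d \<sigma>" and st: "s \<in> carrier \<Gamma>" "t \<in> carrier \<Gamma>" and "\<zeta> > 0"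
  shows "\<forall>\<^sub>F i in sequentially.
           real (card {v\<in>{1..d i}. \<sigma> i s (\<sigma> i t v) \<noteq> \<sigma> i (s \<otimes>\<^bsub>\<Gamma>\<^esub> t) v}) \<le> \<zeta> * real (d i)"
proof -
  let ?E = "\<lambda>i. {v\<in>{1..d i}. \<sigma> i s (\<sigma> i t v) = \<sigma> i (s \<otimes>\<^bsub>\<Gamma>\<^esub> t) v}"
  let ?N = "\<lambda>i. {v\<in>{1..d i}. \<sigma> i s (\<sigma> i t v) \<noteq> \<sigma> i (s \<otimes>\<^bsub>\<Gamma>\<^esub> t) v}"
  have "(\<lambda>i. real (card (?E i)) / real (d i)) \<longlonglongrightarrow> 1"
    using \<sigma> st unfolding sofic_approximation_def by blast
  then have "\<forall>\<^sub>F i in sequentially. 1 - \<zeta> < real (card (?E i)) / real (d i)"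
    by (rule order_tendstoD) (use \<open>\<zeta> > 0\<close> in simp)
  moreover note sofic_approximation_eventually_ge[OF \<sigma>, of 1]
  ultimately show ?thesis
  proof eventually_elim
    case (elim i)
    have "card (?E i) + card (?N i) = card (?E i \<union> ?N i)"
      by (rule card_Un_disjoint[symmetric]) auto
    also have "?E i \<union> ?N i = {1..d i}" by auto
    finally have "real (card (?E i)) + real (card (?N i)) = real (d i)"
      by (simp flip: of_nat_add)
    moreover have "(1 - \<zeta>) * real (d i) < real (card (?E i))" using elim by (simp add: pos_less_divide_eq)
    ultimately show ?case by (simp add: algebra_simps)
  qed
qed

text \<open>By the control lemma it suffices that finitely many \<open>\<rho>\<close>-translates of
  \<open>\<alpha> t (\<phi> v)\<close> and \<open>\<phi> (\<sigma> i t v)\<close> are close, for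
  most \<open>v\<close>. Almost equivariance under \<open>s\<close> and under the product
  \<open>s t\<close>, with almost multiplicativity of \<open>\<sigma> i\<close>, gives this for all
  large \<open>i\<close>.\<close>

lemma Map_sofic_eventually_subset:
  assumes "group \<Gamma>" and \<sigma>: "sofic_approximation \<Gamma> d \<sigma>" and sys: "dynamical_system \<Gamma> X \<alpha>"
    and \<rho>: "continuous_pseudometric X \<rho>" and gen: "dynamically_generating \<Gamma> X \<alpha> \<rho>"
    and \<tau>: "continuous_pseudometric X \<tau>"
    and F: "finite F" "F \<subseteq> carrier \<Gamma>" and "\<delta> > 0"
  obtains F' \<delta>' where "finite F'" "F' \<noteq> {}" "F' \<subseteq> carrier \<Gamma>" "\<delta>' > (0::real)"
    "\<forall>\<^sub>F i in sequentially. Map_sofic X \<alpha> \<rho> F' \<delta>' (d i) (\<sigma> i) \<subseteq> Map_sofic X \<alpha> \<tau> F \<delta> (d i) (\<sigma> i)"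
proof -
  interpret group \<Gamma> by fact
  have X: "compact_space X" and act: "group_action \<Gamma> (topspace X) \<alpha>"
    and \<alpha>: "\<And>s. s \<in> carrier \<Gamma> \<Longrightarrow> continuous_map X X (\<alpha> s)"
    using sys by (auto simp: dynamical_system_def)
  have \<alpha>X: "\<alpha> s x \<in> topspace X" if "s \<in> carrier \<Gamma>" "x \<in> topspace X" for s x
    using continuous_map_funspace[OF \<alpha>] that by blast
  obtain C where C: "C > 0" "\<forall>x\<in>topspace X. \<forall>x'\<in>topspace X. \<tau> x x' \<le> C"
    by (rule continuous_pseudometric_bounded[OF X \<tau>])
  \<comment> \<open>With these values \<open>\<kappa>\<^sup>2\<close> is a quarter and
    \<open>C\<^sup>2 * \<eta>\<close> a half of \<open>\<delta>\<^sup>2\<close>, as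
    \<open>rho_2_leI\<close> requires.\<close>
  define \<kappa> where "\<kappa> = \<delta> / 2"
  define \<eta> where "\<eta> = \<delta>\<^sup>2 / (2 * C\<^sup>2)"
  have "\<kappa> > 0" "\<eta> > 0" using \<open>\<delta> > 0\<close> C by (auto simp: \<kappa>_def \<eta>_def)
  have \<kappa>\<eta>: "\<kappa>\<^sup>2 + C\<^sup>2 * \<eta> \<le> \<delta>\<^sup>2"
    using C by (simp add: \<kappa>_def \<eta>_def power_divide)
  obtain F0 \<kappa>' where F0: "finite F0" "F0 \<noteq> {}" "F0 \<subseteq> carrier \<Gamma>" and "\<kappa>' > 0"
    and ctrl: "\<forall>x\<in>topspace X. \<forall>x'\<in>topspace X. (\<forall>s\<in>F0. \<rho> (\<alpha> s x) (\<alpha> s x') < \<kappa>') \<longrightarrow> \<tau> x x' < \<kappa>"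
    by (rule dynamically_generating_controls[OF \<open>group \<Gamma>\<close> X \<alpha> \<rho> gen \<tau> \<open>\<kappa> > 0\<close>])
  define F' where "F' = F0 \<union> (\<lambda>(s, t). s \<otimes>\<^bsub>\<Gamma>\<^esub> t) ` (F0 \<times> F)"
  \<comment> \<open>For each \<open>s\<close> in \<open>F0\<close> three exceptional sets, of
    density at most \<open>\<zeta> / 2\<close>, \<open>\<zeta>\<close> and
    \<open>\<zeta> / 2\<close>, are discarded; over all of \<open>F0\<close> this totals
    \<open>\<eta>\<close>.\<close>
  define \<zeta> where "\<zeta> = \<eta> / (2 * real (card F0))"
  have "card F0 > 0" using F0 by (simp add: card_gt_0_iff)
  then have "\<zeta> > 0" using \<open>\<eta> > 0\<close> by (simp add: \<zeta>_def)
  \<comment> \<open>Chosen so that Chebyshev at level \<open>\<kappa>' / 2\<close> leaves a fraction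
    \<open>\<zeta> / 2\<close>.\<close>
  define \<delta>' where "\<delta>' = \<kappa>' / 2 * sqrt (\<zeta> / 2)"
  have "\<delta>' > 0" using \<open>\<kappa>' > 0\<close> \<open>\<zeta> > 0\<close> by (simp add: \<delta>'_def)
  have \<delta>': "(\<delta>' / (\<kappa>' / 2))\<^sup>2 = \<zeta> / 2" using \<open>\<kappa>' > 0\<close> \<open>\<zeta> > 0\<close> by (simp add: \<delta>'_def)
  show thesis
  proof (rule that[of F' \<delta>'])
    show "finite F'" "F' \<noteq> {}" using F F0 by (auto simp: F'_def)
    show "F' \<subseteq> carrier \<Gamma>" using F F0 by (auto simp: F'_def)
    show "\<delta>' > 0" by fact
    have "\<forall>\<^sub>F i in sequentially. \<forall>p\<in>F0 \<times> F. real (card {v\<in>{1..d i}.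
        \<sigma> i (fst p) (\<sigma> i (snd p) v) \<noteq> \<sigma> i (fst p \<otimes>\<^bsub>\<Gamma>\<^esub> snd p) v}) \<le> \<zeta> * real (d i)"
    proof (rule eventually_ball_finite)
      show "\<forall>p\<in>F0 \<times> F. \<forall>\<^sub>F i in sequentially. real (card {v\<in>{1..d i}.
        \<sigma> i (fst p) (\<sigma> i (snd p) v) \<noteq> \<sigma> i (fst p \<otimes>\<^bsub>\<Gamma>\<^esub> snd p) v}) \<le> \<zeta> * real (d i)"
        using F F0 \<open>\<zeta> > 0\<close> by (intro ballI sofic_approximation_eventually_mult[OF \<sigma>]) auto
    qed (use F F0 in auto)
    then show "\<forall>\<^sub>F i in sequentially. Map_sofic X \<alpha> \<rho> F' \<delta>' (d i) (\<sigma> i) \<subseteq> Map_sofic X \<alpha> \<tau> F \<delta> (d i) (\<sigma> i)"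
      using sofic_approximation_eventually_ge[OF \<sigma>, of 1]
    proof eventually_elim
      case (elim i)
      define D where "D = d i"
      define S where "S = \<sigma> i"
      have "D > 0" using elim by (simp add: D_def)
      have perm: "S s permutes {1..D}" if "s \<in> carrier \<Gamma>" for s
        using sofic_approximation_permutes[OF \<sigma> that] by (simp add: S_def D_def)
      have mult: "real (card {v\<in>{1..D}. S s (S t v) \<noteq> S (s \<otimes>\<^bsub>\<Gamma>\<^esub> t) v}) \<le> \<zeta> * real D"
        if "s \<in> F0" "t \<in> F" for s t
        using bspec[OF elim(1), of "(s, t)"] that by (simp add: S_def D_def)
      have "\<phi> \<in> Map_sofic X \<alpha> \<tau> F \<delta> D S" if \<phi>: "\<phi> \<in> Map_sofic X \<alpha> \<rho> F' \<delta>' D S" for \<phi>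
      proof -
        have \<phi>E: "\<phi> \<in> {1..D} \<rightarrow>\<^sub>E topspace X"
          and le: "\<And>s. s \<in> F' \<Longrightarrow> rho_2 D \<rho> (\<lambda>v. \<alpha> s (\<phi> v)) (\<phi> \<circ> S s) \<le> \<delta>'"
          using \<phi> by (auto simp: Map_sofic_def)
        have \<phi>X: "\<phi> v \<in> topspace X" if "v \<in> {1..D}" for v using \<phi>E that by blast
        have cheb: "real (card {v\<in>{1..D}. \<kappa>' / 2 \<le> \<rho> (\<alpha> s (\<phi> v)) (\<phi> (S s v))}) \<le> \<zeta> / 2 * real D"
          if "s \<in> F'" for s
          using rho_2_chebyshev[OF le[OF that] \<open>D > 0\<close>, of "\<kappa>' / 2"] \<open>\<kappa>' > 0\<close> unfolding \<delta>' by simp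
        have "rho_2 D \<tau> (\<lambda>v. \<alpha> t (\<phi> v)) (\<phi> \<circ> S t) \<le> \<delta>" if t: "t \<in> F" for t
        proof (rule rho_2_leI[OF _ _ \<kappa>\<eta> \<open>D > 0\<close>])
          have tG: "t \<in> carrier \<Gamma>" using t F by blast
          have StD: "S t v \<in> {1..D}" if "v \<in> {1..D}" for v
            using permutes_in_image[OF perm[OF tG]] that by blast
          show "0 \<le> \<tau> (\<alpha> t (\<phi> v)) ((\<phi> \<circ> S t) v) \<and> \<tau> (\<alpha> t (\<phi> v)) ((\<phi> \<circ> S t) v) \<le> C"
            if v: "v \<in> {1..D}" for v
            using \<phi>X[OF v] \<phi>X[OF StD[OF v]] \<alpha>X[OF tG] \<tau> C(2)
            by (simp add: continuous_pseudometric_def)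
          \<comment> \<open>The three ways to fail at \<open>v\<close>: equivariance under the
            product \<open>s t\<close> at \<open>v\<close>, multiplicativity at \<open>v\<close>,
            and equivariance under \<open>s\<close> at the moved coordinate
            \<open>S t v\<close>.\<close>
          define A where "A s = {v\<in>{1..D}. \<kappa>' / 2 \<le> \<rho> (\<alpha> (s \<otimes>\<^bsub>\<Gamma>\<^esub> t) (\<phi> v)) (\<phi> (S (s \<otimes>\<^bsub>\<Gamma>\<^esub> t) v))}" for s
          define B where "B s = {v\<in>{1..D}. S s (S t v) \<noteq> S (s \<otimes>\<^bsub>\<Gamma>\<^esub> t) v}" for s
          define E where "E s = {v\<in>{1..D}. \<kappa>' / 2 \<le> \<rho> (\<alpha> s (\<phi> v)) (\<phi> (S s v))}" for s
          define E' where "E' s = {v\<in>{1..D}. S t v \<in> E s}" for s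
          have cA: "real (card (A s)) \<le> \<zeta> / 2 * real D" if "s \<in> F0" for s
            unfolding A_def by (rule cheb) (use that t in \<open>auto simp: F'_def\<close>)
          have cB: "real (card (B s)) \<le> \<zeta> * real D" if "s \<in> F0" for s
            unfolding B_def by (rule mult[OF that t])
          \<comment> \<open>\<open>S t\<close> is injective, so the preimage \<open>E' s\<close> is
            no larger than \<open>E s\<close>.\<close>
          have cE: "real (card (E' s)) \<le> \<zeta> / 2 * real D" if "s \<in> F0" for s
          proof -
            have "card (E' s) = card (S t ` E' s)"
              by (rule card_image[symmetric]) (rule permutes_inj_on[OF perm[OF tG]])
            also have "\<dots> \<le> card (E s)" by (rule card_mono) (auto simp: E_def E'_def)
            finally show ?thesis using cheb[of s] that unfolding E_def F'_def by force
          qed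
          have "{v\<in>{1..D}. \<kappa> \<le> \<tau> (\<alpha> t (\<phi> v)) ((\<phi> \<circ> S t) v)} \<subseteq> (\<Union>s\<in>F0. A s \<union> B s \<union> E' s)"
          proof (rule subsetI, rule ccontr)
            fix v assume "v \<in> {v\<in>{1..D}. \<kappa> \<le> \<tau> (\<alpha> t (\<phi> v)) ((\<phi> \<circ> S t) v)}"
              and nv: "v \<notin> (\<Union>s\<in>F0. A s \<union> B s \<union> E' s)"
            then have v: "v \<in> {1..D}" and far: "\<kappa> \<le> \<tau> (\<alpha> t (\<phi> v)) (\<phi> (S t v))" by auto
            have "\<rho> (\<alpha> s (\<alpha> t (\<phi> v))) (\<alpha> s (\<phi> (S t v))) < \<kappa>'" if s: "s \<in> F0" for s
            proof -
              have sG: "s \<in> carrier \<Gamma>" using s F0 by blast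
              have "v \<notin> A s" "v \<notin> B s" "v \<notin> E' s" using nv s by auto
              then have 1: "\<rho> (\<alpha> (s \<otimes>\<^bsub>\<Gamma>\<^esub> t) (\<phi> v)) (\<phi> (S (s \<otimes>\<^bsub>\<Gamma>\<^esub> t) v)) < \<kappa>' / 2"
                and 2: "S s (S t v) = S (s \<otimes>\<^bsub>\<Gamma>\<^esub> t) v"
                and 3: "\<rho> (\<alpha> s (\<phi> (S t v))) (\<phi> (S s (S t v))) < \<kappa>' / 2"
                using v StD[OF v] by (auto simp: A_def B_def E_def E'_def)
              have 4: "\<alpha> (s \<otimes>\<^bsub>\<Gamma>\<^esub> t) (\<phi> v) = \<alpha> s (\<alpha> t (\<phi> v))"
                by (rule group_action.composition_rule[OF act \<phi>X[OF v] sG tG])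
              \<comment> \<open>The middle point \<open>y\<close> is within
                \<open>\<kappa>' / 2\<close> of both: of \<open>x\<close> because it equals the
                value of \<open>\<phi>\<close> at the coordinate moved by \<open>s t\<close>, of
                \<open>z\<close> by equivariance under \<open>s\<close>.\<close>
              define x y z where "x = \<alpha> s (\<alpha> t (\<phi> v))" and "y = \<phi> (S s (S t v))"
                and "z = \<alpha> s (\<phi> (S t v))"
              have "S s (S t v) \<in> {1..D}" using permutes_in_image[OF perm[OF sG]] StD[OF v] by blast
              then have "x \<in> topspace X" "y \<in> topspace X" "z \<in> topspace X"
                using \<phi>X v StD[OF v] \<alpha>X sG tG by (auto simp: x_def y_def z_def)
              then have "\<rho> x z \<le> \<rho> x y + \<rho> y z" "\<rho> y z = \<rho> z y"
                using \<rho> unfolding continuous_pseudometric_def by blast+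
              moreover have "\<rho> x y < \<kappa>' / 2" "\<rho> z y < \<kappa>' / 2"
                using 1 3 unfolding 2[symmetric] 4 x_def y_def z_def by auto
              ultimately show ?thesis unfolding x_def z_def by linarith
            qed
            then have "\<tau> (\<alpha> t (\<phi> v)) (\<phi> (S t v)) < \<kappa>"
              using ctrl \<alpha>X[OF tG \<phi>X[OF v]] \<phi>X[OF StD[OF v]] by blast
            then show False using far by simp
          qed
          then have "card {v\<in>{1..D}. \<kappa> \<le> \<tau> (\<alpha> t (\<phi> v)) ((\<phi> \<circ> S t) v)} \<le> card (\<Union>s\<in>F0. A s \<union> B s \<union> E' s)"
            by (rule card_mono[rotated]) (use F0 in \<open>auto simp: A_def B_def E'_def\<close>)
          also have "\<dots> \<le> (\<Sum>s\<in>F0. card (A s \<union> B s \<union> E' s))" using F0 by (intro card_UN_le)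
          finally have "real (card {v\<in>{1..D}. \<kappa> \<le> \<tau> (\<alpha> t (\<phi> v)) ((\<phi> \<circ> S t) v)}) \<le>
              (\<Sum>s\<in>F0. real (card (A s \<union> B s \<union> E' s)))"
            by (simp flip: of_nat_sum)
          also have "\<dots> \<le> (\<Sum>s\<in>F0. 2 * \<zeta> * real D)"
          proof (rule sum_mono)
            fix s assume s: "s \<in> F0"
            have "card (A s \<union> B s \<union> E' s) \<le> card (A s) + card (B s) + card (E' s)"
              by (meson add_right_mono card_Un_le order_trans)
            then show "real (card (A s \<union> B s \<union> E' s)) \<le> 2 * \<zeta> * real D"
              using cA[OF s] cB[OF s] cE[OF s] by simp
          qed
          also have "\<dots> = \<eta> * real D" using \<open>card F0 > 0\<close> by (simp add: \<zeta>_def)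
          finally show "real (card {v\<in>{1..D}. \<kappa> \<le> \<tau> (\<alpha> t (\<phi> v)) ((\<phi> \<circ> S t) v)}) \<le> \<eta> * real D" .
        qed (use \<open>\<delta> > 0\<close> in simp)
        then show ?thesis using \<phi>E by (simp add: Map_sofic_def)
      qed
      then show ?case by (auto simp: S_def D_def)
    qed
  qed
qed

subsection \<open>Independence of the pseudometrics\<close>


lemma continuous_pseudometric_net:
  assumes X: "compact_space X" and \<tau>: "continuous_pseudometric X \<tau>" and "r > 0"
  obtains C where "finite C" "C \<subseteq> topspace X" "\<forall>x\<in>topspace X. \<exists>c\<in>C. \<tau> x c < r"
proof -
  define U where "U c = {x \<in> topspace X. \<tau> x c \<in> {..<r}}" for c
  have op: "openin X (U c)" if c: "c \<in> topspace X" for c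
    unfolding U_def
    by (rule openin_continuous_map_preimage[OF continuous_map_pseudometric[OF \<tau>]]) (use c in auto)
  have "topspace X \<subseteq> \<Union>(U ` topspace X)"
  proof
    fix x assume "x \<in> topspace X"
    moreover then have "x \<in> U x" using \<tau> \<open>r > 0\<close> by (simp add: U_def continuous_pseudometric_def)
    ultimately show "x \<in> \<Union>(U ` topspace X)" by blast
  qed
  moreover have "\<forall>V\<in>U ` topspace X. openin X V" using op by blast
  ultimately obtain \<F> where "finite \<F>" "\<F> \<subseteq> U ` topspace X" "topspace X \<subseteq> \<Union>\<F>"
    using X unfolding compact_space_alt by meson
  then obtain C where C: "finite C" "C \<subseteq> topspace X" "topspace X \<subseteq> \<Union>(U ` C)"
    using finite_subset_image[of \<F> U "topspace X"] by blast
  then have "\<forall>x\<in>topspace X. \<exists>c\<in>C. \<tau> x c < r" unfolding U_def by blast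
  then show thesis using that C by blast
qed

lemma Map_sofic_mono:
  "F \<subseteq> F' \<Longrightarrow> \<delta>' \<le> \<delta> \<Longrightarrow> Map_sofic X \<alpha> \<rho> F' \<delta>' d \<sigma> \<subseteq> Map_sofic X \<alpha> \<rho> F \<delta> d \<sigma>"
  unfolding Map_sofic_def by force

lemma compactin_Map_sofic:
  assumes "compact_space X" "continuous_pseudometric X \<rho>" "F \<noteq> {}"
    "\<And>s. s \<in> F \<Longrightarrow> continuous_map X X (\<alpha> s)" "\<And>s. s \<in> F \<Longrightarrow> \<sigma> s permutes {1..d}"
  shows "compactin (product_topology (\<lambda>_. X) {1..d}) (Map_sofic X \<alpha> \<rho> F \<delta> d \<sigma>)"
proof (rule closedin_compact_space)
  show "compact_space (product_topology (\<lambda>_. X) {1..d})"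
    using assms(1) by (simp add: compact_space_product_topology)
qed (rule closedin_Map_sofic[OF assms(2-)])

lemma pseudometric_four_points:
  assumes "continuous_pseudometric X \<rho>" "a \<in> topspace X" "b \<in> topspace X" "a' \<in> topspace X" "b' \<in> topspace X"
  shows "\<rho> a b \<le> \<rho> a a' + \<rho> a' b' + \<rho> b b'"
proof -
  have "\<rho> a b \<le> \<rho> a a' + \<rho> a' b" "\<rho> a' b \<le> \<rho> a' b' + \<rho> b' b" "\<rho> b' b = \<rho> b b'"
    using assms unfolding continuous_pseudometric_def by blast+
  then show ?thesis by linarith
qed

definition mdim_term ::
  "(nat \<Rightarrow> nat) \<Rightarrow> (nat \<Rightarrow> 'g \<Rightarrow> nat \<Rightarrow> nat) \<Rightarrow> 'x topology \<Rightarrow> ('g \<Rightarrow> 'x \<Rightarrow> 'x) \<Rightarrow> ('x \<Rightarrow> 'y) \<Rightarrow>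
   ('x \<Rightarrow> 'x \<Rightarrow> real) \<Rightarrow> ('y \<Rightarrow> 'y \<Rightarrow> real) \<Rightarrow> real \<Rightarrow> real \<Rightarrow> 'g set \<Rightarrow> real \<Rightarrow> ereal" where
  "mdim_term d \<sigma> X \<alpha> \<pi> \<rho>X \<rho>Y \<epsilon> \<theta> F \<delta> =
     (if \<forall>\<^sub>F i in sequentially. Map_sofic X \<alpha> \<rho>X F \<delta> (d i) (\<sigma> i) = {} then - \<infinity>
      else limsup (\<lambda>i. Wdim X \<pi> (d i) \<epsilon> (Map_sofic X \<alpha> \<rho>X F \<delta> (d i) (\<sigma> i)) \<theta> \<rho>X \<rho>Y
                        / ereal (real (d i))))"

lemma mdim_alt_def:
  "mdim \<Gamma> d \<sigma> X \<alpha> \<pi> \<rho>X \<rho>Y =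
     (SUP \<epsilon>\<in>{0<..}. INF \<theta>\<in>{0<..}. INF F\<in>{F. finite F \<and> F \<noteq> {} \<and> F \<subseteq> carrier \<Gamma>}. INF \<delta>\<in>{0<..}.
        mdim_term d \<sigma> X \<alpha> \<pi> \<rho>X \<rho>Y \<epsilon> \<theta> F \<delta>)"
  by (simp add: mdim_def mdim_term_def)

text \<open>The inclusion \<open>sub\<close> serves the convention for empty sets: if the second
  family is eventually empty, so is the first, and both sides are \<open>-\<infinity>\<close>.
  Otherwise the bound on widths is divided by \<open>d i\<close> and passed to the limsup.\<close>

lemma mdim_term_le_add:
  assumes sub: "\<forall>\<^sub>F i in sequentially.
      Map_sofic X \<alpha> \<rho>X1 F1 \<delta>1 (d i) (\<sigma> i) \<subseteq> Map_sofic X \<alpha> \<rho>X2 F2 \<delta>2 (d i) (\<sigma> i)"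
    and W: "\<forall>\<^sub>F i in sequentially. d i > 0 \<and>
      Wdim X \<pi> (d i) \<epsilon>1 (Map_sofic X \<alpha> \<rho>X1 F1 \<delta>1 (d i) (\<sigma> i)) \<theta>1 \<rho>X1 \<rho>Y1 \<le>
      Wdim X \<pi> (d i) \<epsilon>2 (Map_sofic X \<alpha> \<rho>X2 F2 \<delta>2 (d i) (\<sigma> i)) \<theta>2 \<rho>X2 \<rho>Y2 + ereal (\<eta> * real (d i))"
  shows "mdim_term d \<sigma> X \<alpha> \<pi> \<rho>X1 \<rho>Y1 \<epsilon>1 \<theta>1 F1 \<delta>1 \<le> mdim_term d \<sigma> X \<alpha> \<pi> \<rho>X2 \<rho>Y2 \<epsilon>2 \<theta>2 F2 \<delta>2 + ereal \<eta>"
proof (cases "\<forall>\<^sub>F i in sequentially. Map_sofic X \<alpha> \<rho>X1 F1 \<delta>1 (d i) (\<sigma> i) = {}")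
  case True
  then show ?thesis by (simp add: mdim_term_def)
next
  case False
  have ne: "\<not> (\<forall>\<^sub>F i in sequentially. Map_sofic X \<alpha> \<rho>X2 F2 \<delta>2 (d i) (\<sigma> i) = {})"
  proof
    assume "\<forall>\<^sub>F i in sequentially. Map_sofic X \<alpha> \<rho>X2 F2 \<delta>2 (d i) (\<sigma> i) = {}"
    then have "\<forall>\<^sub>F i in sequentially. Map_sofic X \<alpha> \<rho>X1 F1 \<delta>1 (d i) (\<sigma> i) = {}"
      using sub by eventually_elim auto
    then show False using False by simp
  qed
  define W1 where "W1 i = Wdim X \<pi> (d i) \<epsilon>1 (Map_sofic X \<alpha> \<rho>X1 F1 \<delta>1 (d i) (\<sigma> i)) \<theta>1 \<rho>X1 \<rho>Y1" for i
  define W2 where "W2 i = Wdim X \<pi> (d i) \<epsilon>2 (Map_sofic X \<alpha> \<rho>X2 F2 \<delta>2 (d i) (\<sigma> i)) \<theta>2 \<rho>X2 \<rho>Y2" for i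
  have "\<forall>\<^sub>F i in sequentially. W1 i / ereal (real (d i)) \<le> W2 i / ereal (real (d i)) + ereal \<eta>"
    using W unfolding W1_def[symmetric] W2_def[symmetric]
  proof eventually_elim
    case (elim i)
    then have "W1 i / ereal (real (d i)) \<le> (W2 i + ereal (\<eta> * real (d i))) / ereal (real (d i))"
      by (intro ereal_divide_right_mono) auto
    also have "\<dots> = W2 i / ereal (real (d i)) + ereal \<eta>"
      using elim by (cases "W2 i") (auto simp: field_simps)
    finally show ?case .
  qed
  then have "limsup (\<lambda>i. W1 i / ereal (real (d i))) \<le> limsup (\<lambda>i. W2 i / ereal (real (d i)) + ereal \<eta>)"
    by (rule Limsup_mono)
  also have "\<dots> = limsup (\<lambda>i. W2 i / ereal (real (d i))) + ereal \<eta>"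
    by (rule Limsup_add_ereal_right) auto
  finally show ?thesis using False ne by (simp add: mdim_term_def W1_def W2_def)
qed

text \<open>Both pseudometrics are exchanged at once in one inequality, so that equality follows by
  swapping the two pairs.\<close>

lemma mdim_le:
  assumes \<Gamma>: "group \<Gamma>" and \<sigma>: "sofic_approximation \<Gamma> d \<sigma>"
    and sysX: "dynamical_system \<Gamma> X \<alpha>" and sysY: "dynamical_system \<Gamma> Y \<beta>"
    and fac: "factor_map \<Gamma> X \<alpha> Y \<beta> \<pi>"
    and \<rho>X1: "continuous_pseudometric X \<rho>X1" "dynamically_generating \<Gamma> X \<alpha> \<rho>X1"
    and \<rho>X2: "continuous_pseudometric X \<rho>X2" "dynamically_generating \<Gamma> X \<alpha> \<rho>X2"
    and \<rho>Y1: "continuous_pseudometric Y \<rho>Y1" "dynamically_generating \<Gamma> Y \<beta> \<rho>Y1"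
    and \<rho>Y2: "continuous_pseudometric Y \<rho>Y2"
  shows "mdim \<Gamma> d \<sigma> X \<alpha> \<pi> \<rho>X1 \<rho>Y1 \<le> mdim \<Gamma> d \<sigma> X \<alpha> \<pi> \<rho>X2 \<rho>Y2"
proof -
  have X: "compact_space X" and \<alpha>: "\<And>s. s \<in> carrier \<Gamma> \<Longrightarrow> continuous_map X X (\<alpha> s)"
    using sysX by (auto simp: dynamical_system_def)
  have Y: "compact_space Y" and \<beta>: "\<And>s. s \<in> carrier \<Gamma> \<Longrightarrow> continuous_map Y Y (\<beta> s)"
    using sysY by (auto simp: dynamical_system_def)
  have \<pi>: "continuous_map X Y \<pi>" and equiv: "\<And>s x. s \<in> carrier \<Gamma> \<Longrightarrow> x \<in> topspace X \<Longrightarrow> \<pi> (\<alpha> s x) = \<beta> s (\<pi> x)"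
    using fac by (auto simp: factor_map_def)
  have \<alpha>X: "\<alpha> s x \<in> topspace X" if "s \<in> carrier \<Gamma>" "x \<in> topspace X" for s x
    using continuous_map_funspace[OF \<alpha>] that by blast
  have \<pi>Y: "\<pi> x \<in> topspace Y" if "x \<in> topspace X" for x
    using continuous_map_funspace[OF \<pi>] that by blast
  define \<rho>1 where "\<rho>1 x x' = \<rho>Y1 (\<pi> x) (\<pi> x')" for x x'
  define \<rho>2 where "\<rho>2 x x' = \<rho>Y2 (\<pi> x) (\<pi> x')" for x x'
  have \<rho>1: "continuous_pseudometric X \<rho>1" and \<rho>2: "continuous_pseudometric X \<rho>2"
    unfolding \<rho>1_def \<rho>2_def by (rule continuous_pseudometric_pullback[OF _ \<pi>], fact)+
  \<comment> \<open>The sum dominates all four pseudometrics, so a single set of exceptional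
    coordinates and a single net serve them all.\<close>
  define \<tau> where "\<tau> x x' = \<rho>X1 x x' + \<rho>X2 x x' + \<rho>1 x x' + \<rho>2 x x'" for x x'
  have \<tau>: "continuous_pseudometric X \<tau>"
    unfolding \<tau>_def by (intro continuous_pseudometric_add \<rho>X1 \<rho>X2 \<rho>1 \<rho>2)
  have le_\<tau>: "\<rho>X1 x x' \<le> \<tau> x x'" "\<rho>X2 x x' \<le> \<tau> x x'" "\<rho>1 x x' \<le> \<tau> x x'" "\<rho>2 x x' \<le> \<tau> x x'"
    if "x \<in> topspace X" "x' \<in> topspace X" for x x'
  proof -
    have "0 \<le> \<rho>X1 x x'" "0 \<le> \<rho>X2 x x'" "0 \<le> \<rho>1 x x'" "0 \<le> \<rho>2 x x'"
      using that \<rho>X1(1) \<rho>X2(1) \<rho>1 \<rho>2 unfolding continuous_pseudometric_def by simp_all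
    then show "\<rho>X1 x x' \<le> \<tau> x x'" "\<rho>X2 x x' \<le> \<tau> x x'" "\<rho>1 x x' \<le> \<tau> x x'" "\<rho>2 x x' \<le> \<tau> x x'"
      by (auto simp: \<tau>_def)
  qed
  \<comment> \<open>The order of choices follows the supremum and the infima:
    \<open>\<epsilon>2\<close> depends on \<open>\<epsilon>1\<close> alone, whereas
    \<open>\<theta>1\<close>, \<open>F1\<close> and \<open>\<delta>1\<close> may depend on all data
    of the second side and on the error \<open>\<eta>\<close>.\<close>
  have "\<exists>\<epsilon>2>0. \<forall>\<theta>2>0. \<forall>F2 \<delta>2 \<eta>. finite F2 \<and> F2 \<noteq> {} \<and> F2 \<subseteq> carrier \<Gamma> \<and> \<delta>2 > 0 \<and> \<eta> > 0 \<longrightarrow>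
      (\<exists>\<theta>1>0. \<exists>F1. finite F1 \<and> F1 \<noteq> {} \<and> F1 \<subseteq> carrier \<Gamma> \<and> (\<exists>\<delta>1>0.
        mdim_term d \<sigma> X \<alpha> \<pi> \<rho>X1 \<rho>Y1 \<epsilon>1 \<theta>1 F1 \<delta>1 \<le> mdim_term d \<sigma> X \<alpha> \<pi> \<rho>X2 \<rho>Y2 \<epsilon>2 \<theta>2 F2 \<delta>2 + ereal \<eta>))"
    if \<epsilon>1: "\<epsilon>1 > 0" for \<epsilon>1
  proof -
    obtain Fa \<kappa>a where Fa: "finite Fa" "Fa \<noteq> {}" "Fa \<subseteq> carrier \<Gamma>" and \<kappa>a: "\<kappa>a > 0"
      and ctrl_a: "\<forall>x\<in>topspace X. \<forall>x'\<in>topspace X. (\<forall>s\<in>Fa. \<rho>X2 (\<alpha> s x) (\<alpha> s x') < \<kappa>a) \<longrightarrow> \<rho>X1 x x' < \<epsilon>1"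
      by (rule dynamically_generating_controls[OF \<Gamma> X \<alpha> \<rho>X2 \<rho>X1(1) \<epsilon>1])
    \<comment> \<open>Moving translates to coordinates costs \<open>2 * \<kappa>\<close>, at most
      \<open>\<kappa>a / 2\<close>, so the total stays below \<open>\<kappa>a\<close>. The choice of
      \<open>\<theta>1\<close> below follows the same budget with \<open>\<kappa>b\<close>.\<close>
    define \<epsilon>2 where "\<epsilon>2 = \<kappa>a / 4"
    have inner: "\<exists>\<theta>1>0. \<exists>F1. finite F1 \<and> F1 \<noteq> {} \<and> F1 \<subseteq> carrier \<Gamma> \<and> (\<exists>\<delta>1>0.
        mdim_term d \<sigma> X \<alpha> \<pi> \<rho>X1 \<rho>Y1 \<epsilon>1 \<theta>1 F1 \<delta>1 \<le> mdim_term d \<sigma> X \<alpha> \<pi> \<rho>X2 \<rho>Y2 \<epsilon>2 \<theta>2 F2 \<delta>2 + ereal \<eta>)"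
      if \<theta>2: "\<theta>2 > 0" and F2: "finite F2" "F2 \<noteq> {}" "F2 \<subseteq> carrier \<Gamma>" and \<delta>2: "\<delta>2 > 0" and \<eta>: "\<eta> > 0"
      for \<theta>2 F2 \<delta>2 \<eta>
    proof -
      obtain Fb \<kappa>b where Fb: "finite Fb" "Fb \<noteq> {}" "Fb \<subseteq> carrier \<Gamma>" and \<kappa>b: "\<kappa>b > 0"
        and ctrl_b: "\<forall>y\<in>topspace Y. \<forall>y'\<in>topspace Y. (\<forall>s\<in>Fb. \<rho>Y1 (\<beta> s y) (\<beta> s y') < \<kappa>b) \<longrightarrow> \<rho>Y2 y y' < \<theta>2"
        by (rule dynamically_generating_controls[OF \<Gamma> Y \<beta> \<rho>Y1 \<rho>Y2 \<theta>2])
      define \<theta>1 where "\<theta>1 = \<kappa>b / 4"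
      define \<kappa> where "\<kappa> = min \<kappa>a \<kappa>b / 4"
      define F0 where "F0 = Fa \<union> Fb"
      \<comment> \<open>Two points \<open>r\<close>-close to a common net point are closer than both
        \<open>\<epsilon>1\<close> and \<open>\<theta>2\<close>.\<close>
      define r where "r = min \<epsilon>1 \<theta>2 / 3"
      have \<kappa>: "\<kappa> > 0" "\<kappa> \<le> \<kappa>a / 4" "\<kappa> \<le> \<kappa>b / 4" using \<kappa>a \<kappa>b by (auto simp: \<kappa>_def)
      have F0: "finite F0" "F0 \<noteq> {}" "F0 \<subseteq> carrier \<Gamma>" using Fa Fb by (auto simp: F0_def)
      have r: "r > 0" "2 * r < \<epsilon>1" "2 * r < \<theta>2" using \<epsilon>1 \<theta>2 by (auto simp: r_def)
      obtain C where C: "finite C" "C \<subseteq> topspace X" "\<forall>x\<in>topspace X. \<exists>c\<in>C. \<tau> x c < r"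
        by (rule continuous_pseudometric_net[OF X \<tau> r(1)])
      \<comment> \<open>Each \<open>s\<close> in \<open>F0\<close> produces exceptional coordinates,
        and each of these costs \<open>card C\<close> functions; the added 1 keeps \<open>p\<close>
        positive when \<open>C\<close> is empty.\<close>
      define p where "p = real (card F0) * real (card C + 1)"
      have p: "p > 0" using F0 by (simp add: p_def card_gt_0_iff add_pos_nonneg)
      \<comment> \<open>Makes the Chebyshev fraction \<open>\<eta> / (2 * p)\<close>, so the
        additional functions number at most \<open>\<eta> / 2\<close> times
        \<open>d i\<close>.\<close>
      define \<delta>0 where "\<delta>0 = \<kappa> * sqrt (\<eta> / (2 * p))"
      have \<delta>0: "\<delta>0 > 0" "(\<delta>0 / \<kappa>)\<^sup>2 = \<eta> / (2 * p)"
        using \<kappa> \<eta> p by (auto simp: \<delta>0_def)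
      \<comment> \<open>Almost equivariance for \<open>\<tau>\<close> will bound the exceptional
        coordinates; that for \<open>\<rho>X2\<close>, obtained next, gives the inclusion of the map
        spaces.\<close>
      obtain Fc \<delta>c where Fc: "finite Fc" "Fc \<noteq> {}" "Fc \<subseteq> carrier \<Gamma>" and \<delta>c: "\<delta>c > 0" and sub_c:
        "\<forall>\<^sub>F i in sequentially. Map_sofic X \<alpha> \<rho>X1 Fc \<delta>c (d i) (\<sigma> i) \<subseteq> Map_sofic X \<alpha> \<tau> F0 \<delta>0 (d i) (\<sigma> i)"
        by (rule Map_sofic_eventually_subset[OF \<Gamma> \<sigma> sysX \<rho>X1 \<tau> F0(1,3) \<delta>0(1)])
      obtain Fd \<delta>d where Fd: "finite Fd" "Fd \<noteq> {}" "Fd \<subseteq> carrier \<Gamma>" and \<delta>d: "\<delta>d > 0" and sub_d: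
        "\<forall>\<^sub>F i in sequentially. Map_sofic X \<alpha> \<rho>X1 Fd \<delta>d (d i) (\<sigma> i) \<subseteq> Map_sofic X \<alpha> \<rho>X2 F2 \<delta>2 (d i) (\<sigma> i)"
        by (rule Map_sofic_eventually_subset[OF \<Gamma> \<sigma> sysX \<rho>X1 \<rho>X2(1) F2(1,3) \<delta>2])
      define F1 where "F1 = Fc \<union> Fd"
      define \<delta>1 where "\<delta>1 = min \<delta>c \<delta>d"
      have F1: "finite F1" "F1 \<noteq> {}" "F1 \<subseteq> carrier \<Gamma>" using Fc Fd by (auto simp: F1_def)
      have sub1: "\<forall>\<^sub>F i in sequentially. Map_sofic X \<alpha> \<rho>X1 F1 \<delta>1 (d i) (\<sigma> i) \<subseteq> Map_sofic X \<alpha> \<tau> F0 \<delta>0 (d i) (\<sigma> i)"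
        using sub_c
      proof eventually_elim
        case (elim i)
        then show ?case using Map_sofic_mono[of Fc F1 \<delta>1 \<delta>c X \<alpha> \<rho>X1 "d i" "\<sigma> i"]
          by (auto simp: F1_def \<delta>1_def)
      qed
      have sub2: "\<forall>\<^sub>F i in sequentially. Map_sofic X \<alpha> \<rho>X1 F1 \<delta>1 (d i) (\<sigma> i) \<subseteq> Map_sofic X \<alpha> \<rho>X2 F2 \<delta>2 (d i) (\<sigma> i)"
        using sub_d
      proof eventually_elim
        case (elim i)
        then show ?case using Map_sofic_mono[of Fd F1 \<delta>1 \<delta>d X \<alpha> \<rho>X1 "d i" "\<sigma> i"]
          by (auto simp: F1_def \<delta>1_def)
      qed
      have "\<forall>\<^sub>F i in sequentially. d i > 0 \<and>
        Wdim X \<pi> (d i) \<epsilon>1 (Map_sofic X \<alpha> \<rho>X1 F1 \<delta>1 (d i) (\<sigma> i)) \<theta>1 \<rho>X1 \<rho>Y1 \<le>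
        Wdim X \<pi> (d i) \<epsilon>2 (Map_sofic X \<alpha> \<rho>X2 F2 \<delta>2 (d i) (\<sigma> i)) \<theta>2 \<rho>X2 \<rho>Y2 + ereal (\<eta> * real (d i))"
        using sub1 sub2 sofic_approximation_eventually_ge[OF \<sigma>, of "max 1 (nat \<lceil>2 / \<eta>\<rceil>)"]
      proof eventually_elim
        case (elim i)
        define D where "D = d i"
        define S where "S = \<sigma> i"
        define K1 where "K1 = Map_sofic X \<alpha> \<rho>X1 F1 \<delta>1 D S"
        define K2 where "K2 = Map_sofic X \<alpha> \<rho>X2 F2 \<delta>2 D S"
        have D: "D > 0" "2 / \<eta> \<le> real D" using elim(3) by (auto simp: D_def)
        have K1\<tau>: "K1 \<subseteq> Map_sofic X \<alpha> \<tau> F0 \<delta>0 D S" and K12: "K1 \<subseteq> K2"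
          using elim by (auto simp: K1_def K2_def D_def S_def)
        have perm: "S s permutes {1..D}" if "s \<in> carrier \<Gamma>" for s
          using sofic_approximation_permutes[OF \<sigma> that] by (simp add: S_def D_def)
        have S_in: "S s v \<in> {1..D}" if "s \<in> carrier \<Gamma>" "v \<in> {1..D}" for s v
          using permutes_in_image[OF perm[OF that(1)]] that(2) by blast
        have K1X: "\<phi> v \<in> topspace X" if "\<phi> \<in> K1" "v \<in> {1..D}" for \<phi> v
          using that by (auto simp: K1_def Map_sofic_def)
        \<comment> \<open>A continuous marker that vanishes exactly when \<open>\<phi>\<close> is
          \<open>\<tau>\<close>-equivariant at \<open>v\<close> up to \<open>\<kappa>\<close> for
          all \<open>s\<close> in \<open>F0\<close>.\<close>
        define l where "l v \<phi> = (\<Sum>s\<in>F0. max 0 (\<tau> (\<alpha> s (\<phi> v)) (\<phi> (S s v)) - \<kappa>))" for v \<phi>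
        have l0: "l v \<phi> = 0 \<longleftrightarrow> (\<forall>s\<in>F0. \<tau> (\<alpha> s (\<phi> v)) (\<phi> (S s v)) \<le> \<kappa>)" for v \<phi>
          unfolding l_def using F0 by (subst sum_nonneg_eq_0_iff) (auto simp: max_def)
        define m where "m = nat \<lfloor>real (card F0) * (\<delta>0 / \<kappa>)\<^sup>2 * real D\<rfloor>"
        have l_card: "card {v\<in>{1..D}. l v \<phi> \<noteq> 0} \<le> m" if \<phi>: "\<phi> \<in> K1" for \<phi>
        proof -
          let ?B = "\<lambda>s. {v\<in>{1..D}. \<kappa> \<le> \<tau> (\<alpha> s (\<phi> v)) ((\<phi> \<circ> S s) v)}"
          have cheb: "real (card (?B s)) \<le> (\<delta>0 / \<kappa>)\<^sup>2 * real D" if "s \<in> F0" for s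
          proof -
            have "rho_2 D \<tau> (\<lambda>v. \<alpha> s (\<phi> v)) (\<phi> \<circ> S s) \<le> \<delta>0"
              using K1\<tau> \<phi> that by (auto simp: Map_sofic_def)
            from rho_2_chebyshev[OF this D(1) \<kappa>(1)] show ?thesis .
          qed
          have "card {v\<in>{1..D}. l v \<phi> \<noteq> 0} \<le> card (\<Union>s\<in>F0. ?B s)"
            by (rule card_mono) (use F0 in \<open>force simp: l0\<close>)+
          also have "\<dots> \<le> (\<Sum>s\<in>F0. card (?B s))" using F0 by (intro card_UN_le)
          finally have "real (card {v\<in>{1..D}. l v \<phi> \<noteq> 0}) \<le> (\<Sum>s\<in>F0. real (card (?B s)))"
            by (simp flip: of_nat_sum)
          also have "\<dots> \<le> (\<Sum>s\<in>F0. (\<delta>0 / \<kappa>)\<^sup>2 * real D)" by (rule sum_mono) (rule cheb)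
          also have "\<dots> = real (card F0) * (\<delta>0 / \<kappa>)\<^sup>2 * real D" by simp
          finally show ?thesis unfolding m_def by linarith
        qed
        \<comment> \<open>At coordinates unexceptional for both maps, translating by
          \<open>s\<close> amounts to moving the coordinate by \<open>S s\<close>, with an error
          \<open>\<kappa>\<close> for each map.\<close>
        have transfer: "\<rho> (\<alpha> s (\<phi> v)) (\<alpha> s (\<phi>' v)) \<le> \<rho> (\<phi> (S s v)) (\<phi>' (S s v)) + 2 * \<kappa>"
          if \<rho>: "continuous_pseudometric X \<rho>" "\<And>x x'. x \<in> topspace X \<Longrightarrow> x' \<in> topspace X \<Longrightarrow> \<rho> x x' \<le> \<tau> x x'"
            and \<phi>: "\<phi> \<in> K1" "\<phi>' \<in> K1" and v: "v \<in> {1..D}" and l: "l v \<phi> = 0" "l v \<phi>' = 0" and s: "s \<in> F0"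
          for \<rho> \<phi> \<phi>' v s
        proof -
          have sG: "s \<in> carrier \<Gamma>" using s F0 by blast
          have in_X: "\<alpha> s (\<phi> v) \<in> topspace X" "\<alpha> s (\<phi>' v) \<in> topspace X" "\<phi> (S s v) \<in> topspace X" "\<phi>' (S s v) \<in> topspace X"
            using \<alpha>X[OF sG] K1X \<phi> v S_in[OF sG v] by auto
          have "\<rho> (\<alpha> s (\<phi> v)) (\<phi> (S s v)) \<le> \<kappa>" "\<rho> (\<alpha> s (\<phi>' v)) (\<phi>' (S s v)) \<le> \<kappa>"
            using l s \<rho>(2)[OF in_X(1,3)] \<rho>(2)[OF in_X(2,4)] unfolding l0 by force+
          then show ?thesis using pseudometric_four_points[OF \<rho>(1) in_X] by linarith
        qed
        have "Wdim X \<pi> D \<epsilon>1 K1 \<theta>1 \<rho>X1 \<rho>Y1 \<le> Wdim X \<pi> D \<epsilon>2 K2 \<theta>2 \<rho>X2 \<rho>Y2 + ereal (real (m * card C) + 1)"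
        proof (rule Wdim_le_Wdim_add[OF \<rho>X2(1) \<rho>Y2 \<tau> \<pi> D(1) _ _ K12 C(1,2), where l = l])
          show "compactin (product_topology (\<lambda>_. X) {1..D}) K1"
            unfolding K1_def using F1 by (intro compactin_Map_sofic X \<rho>X1 \<alpha> perm) auto
          show "compactin (product_topology (\<lambda>_. X) {1..D}) K2"
            unfolding K2_def using F2 by (intro compactin_Map_sofic X \<rho>X2 \<alpha> perm) auto
          show "\<exists>c\<in>C. \<tau> x c < r" if "x \<in> topspace X" for x using C that by blast
          show "\<rho>X1 x x' < \<epsilon>1 \<and> \<rho>Y2 (\<pi> x) (\<pi> x') \<le> \<theta>2"
            if "x \<in> topspace X" "x' \<in> topspace X" "\<tau> x x' < 2 * r" for x x'
            using le_\<tau>[OF that(1,2)] that(3) r by (auto simp: \<rho>2_def)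
          show "continuous_map (product_topology (\<lambda>_. X) {1..D}) euclideanreal (l v)" if v: "v \<in> {1..D}" for v
            unfolding l_def
          proof (intro continuous_map_sum continuous_map_real_max continuous_map_diff)
            fix s assume "s \<in> F0"
            then have s: "s \<in> carrier \<Gamma>" using F0 by blast
            show "continuous_map (product_topology (\<lambda>_. X) {1..D}) euclideanreal (\<lambda>\<phi>. \<tau> (\<alpha> s (\<phi> v)) (\<phi> (S s v)))"
            proof (rule continuous_map_pseudometric[OF \<tau>])
              show "continuous_map (product_topology (\<lambda>_. X) {1..D}) X (\<lambda>\<phi>. \<alpha> s (\<phi> v))"
                using continuous_map_compose[OF continuous_map_product_projection[OF v] \<alpha>[OF s]] by (simp add: o_def)
              show "continuous_map (product_topology (\<lambda>_. X) {1..D}) X (\<lambda>\<phi>. \<phi> (S s v))"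
                by (rule continuous_map_product_projection[OF S_in[OF s v]])
            qed
          qed (use F0 in auto)
          show "l v \<phi> \<ge> 0" for v \<phi> unfolding l_def by (intro sum_nonneg) auto
          show "card {v\<in>{1..D}. l v \<phi> \<noteq> 0} \<le> m" if "\<phi> \<in> K1" for \<phi> using l_card that .
        next
          fix \<phi> \<phi>' v assume \<phi>: "\<phi> \<in> K1" "\<phi>' \<in> K1" and v: "v \<in> {1..D}" and l: "l v \<phi> = 0" "l v \<phi>' = 0"
            and inf: "rho_inf D \<rho>X2 \<phi> \<phi>' < \<epsilon>2"
          \<comment> \<open>The uniform bound for \<open>\<rho>X2\<close> is used at the coordinate
            \<open>S s v\<close> and transferred to the \<open>s\<close>-translates at
            \<open>v\<close>, where \<open>ctrl_a\<close> applies.\<close>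
          have "\<rho>X2 (\<alpha> s (\<phi> v)) (\<alpha> s (\<phi>' v)) < \<kappa>a" if s: "s \<in> Fa" for s
          proof -
            have "s \<in> F0" "s \<in> carrier \<Gamma>" using s Fa by (auto simp: F0_def)
            then have "\<rho>X2 (\<phi> (S s v)) (\<phi>' (S s v)) < \<epsilon>2"
              using inf S_in v unfolding rho_inf_less_iff[OF D(1)] by blast
            then show ?thesis
              using transfer[OF \<rho>X2(1) le_\<tau>(2) \<phi> v l \<open>s \<in> F0\<close>] \<kappa> \<kappa>a by (simp add: \<epsilon>2_def)
          qed
          then show "\<rho>X1 (\<phi> v) (\<phi>' v) < \<epsilon>1" using ctrl_a K1X \<phi> v by blast
        next
          fix \<phi> \<phi>' v assume \<phi>: "\<phi> \<in> K1" "\<phi>' \<in> K1" and v: "v \<in> {1..D}" and l: "l v \<phi> = 0" "l v \<phi>' = 0"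
            and inf: "rho_inf D \<rho>Y1 (\<pi> \<circ> \<phi>) (\<pi> \<circ> \<phi>') \<le> \<theta>1"
          \<comment> \<open>The same transfer for the pullback \<open>\<rho>1\<close>; equivariance
            of \<open>\<pi>\<close> turns translates in \<open>X\<close> into translates in
            \<open>Y\<close>.\<close>
          have "\<rho>Y1 (\<beta> s (\<pi> (\<phi> v))) (\<beta> s (\<pi> (\<phi>' v))) < \<kappa>b" if s: "s \<in> Fb" for s
          proof -
            have "s \<in> F0" "s \<in> carrier \<Gamma>" using s Fb by (auto simp: F0_def)
            then have "\<rho>1 (\<phi> (S s v)) (\<phi>' (S s v)) \<le> \<theta>1"
              using inf S_in v unfolding rho_inf_le_iff[OF D(1)] \<rho>1_def by auto
            moreover have "\<rho>1 (\<alpha> s (\<phi> v)) (\<alpha> s (\<phi>' v)) = \<rho>Y1 (\<beta> s (\<pi> (\<phi> v))) (\<beta> s (\<pi> (\<phi>' v)))"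
              using equiv[OF \<open>s \<in> carrier \<Gamma>\<close>] K1X \<phi> v by (simp add: \<rho>1_def)
            ultimately show ?thesis
              using transfer[OF \<rho>1 le_\<tau>(3) \<phi> v l \<open>s \<in> F0\<close>] \<kappa> \<kappa>b by (simp add: \<theta>1_def)
          qed
          then have "\<rho>Y2 (\<pi> (\<phi> v)) (\<pi> (\<phi>' v)) < \<theta>2" using ctrl_b \<pi>Y K1X \<phi> v by blast
          then show "\<rho>Y2 (\<pi> (\<phi> v)) (\<pi> (\<phi>' v)) \<le> \<theta>2" by simp
        qed
        also have "\<dots> \<le> Wdim X \<pi> D \<epsilon>2 K2 \<theta>2 \<rho>X2 \<rho>Y2 + ereal (\<eta> * real D)"
        \<comment> \<open>Half of \<open>\<eta> * real D\<close> pays for the additional functions,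
          the other half for the 1, since \<open>D\<close> is at least
          \<open>2 / \<eta>\<close>.\<close>
        proof (intro add_left_mono, simp only: ereal_less_eq)
          have "real (m * card C) \<le> real m * real (card C + 1)" by (simp add: algebra_simps)
          also have "\<dots> \<le> (real (card F0) * (\<delta>0 / \<kappa>)\<^sup>2 * real D) * real (card C + 1)"
          proof (rule mult_right_mono)
            have "0 \<le> real (card F0) * (\<delta>0 / \<kappa>)\<^sup>2 * real D" by simp
            then show "real m \<le> real (card F0) * (\<delta>0 / \<kappa>)\<^sup>2 * real D" unfolding m_def by linarith
          qed simp
          also have "\<dots> = p * (\<delta>0 / \<kappa>)\<^sup>2 * real D" by (simp add: p_def)
          also have "\<dots> = \<eta> / 2 * real D" using p by (simp add: \<delta>0(2))
          finally have "real (m * card C) \<le> \<eta> / 2 * real D" .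
          moreover have "1 \<le> \<eta> / 2 * real D" using D(2) \<eta> by (simp add: field_simps)
          ultimately show "real (m * card C) + 1 \<le> \<eta> * real D" by simp
        qed
        finally show ?case using D by (simp add: D_def K1_def K2_def S_def)
      qed
      then have "mdim_term d \<sigma> X \<alpha> \<pi> \<rho>X1 \<rho>Y1 \<epsilon>1 \<theta>1 F1 \<delta>1 \<le>
          mdim_term d \<sigma> X \<alpha> \<pi> \<rho>X2 \<rho>Y2 \<epsilon>2 \<theta>2 F2 \<delta>2 + ereal \<eta>"
        by (rule mdim_term_le_add[OF sub2])
      moreover have "\<theta>1 > 0" "\<delta>1 > 0" using \<kappa>b \<delta>c \<delta>d by (auto simp: \<theta>1_def \<delta>1_def)
      ultimately show ?thesis using F1 by blast
    qed
    have "\<epsilon>2 > 0" using \<kappa>a by (simp add: \<epsilon>2_def)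
    then show ?thesis
      by (rule exI[of _ \<epsilon>2, OF conjI]) (intro allI impI, elim conjE, rule inner)
  qed note key = this
  show ?thesis
    unfolding mdim_alt_def
  proof (rule SUP_least)
    fix \<epsilon>1 :: real assume "\<epsilon>1 \<in> {0<..}"
    then obtain \<epsilon>2 where \<epsilon>2: "\<epsilon>2 > 0" and ex: "\<And>\<theta>2 F2 \<delta>2 \<eta>. \<theta>2 > 0 \<Longrightarrow>
      finite F2 \<Longrightarrow> F2 \<noteq> {} \<Longrightarrow> F2 \<subseteq> carrier \<Gamma> \<Longrightarrow> \<delta>2 > 0 \<Longrightarrow> \<eta> > 0 \<Longrightarrow>
      (\<exists>\<theta>1>0. \<exists>F1. finite F1 \<and> F1 \<noteq> {} \<and> F1 \<subseteq> carrier \<Gamma> \<and> (\<exists>\<delta>1>0.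
        mdim_term d \<sigma> X \<alpha> \<pi> \<rho>X1 \<rho>Y1 \<epsilon>1 \<theta>1 F1 \<delta>1 \<le> mdim_term d \<sigma> X \<alpha> \<pi> \<rho>X2 \<rho>Y2 \<epsilon>2 \<theta>2 F2 \<delta>2 + ereal \<eta>))"
      using key[of \<epsilon>1] by auto
    show "(INF \<theta>\<in>{0<..}. INF F\<in>{F. finite F \<and> F \<noteq> {} \<and> F \<subseteq> carrier \<Gamma>}. INF \<delta>\<in>{0<..}.
        mdim_term d \<sigma> X \<alpha> \<pi> \<rho>X1 \<rho>Y1 \<epsilon>1 \<theta> F \<delta>) \<le> (SUP \<epsilon>\<in>{0<..}. INF \<theta>\<in>{0<..}.
        INF F\<in>{F. finite F \<and> F \<noteq> {} \<and> F \<subseteq> carrier \<Gamma>}. INF \<delta>\<in>{0<..}.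
        mdim_term d \<sigma> X \<alpha> \<pi> \<rho>X2 \<rho>Y2 \<epsilon> \<theta> F \<delta>)" (is "?L \<le> _")
    proof (rule SUP_upper2)
      show "\<epsilon>2 \<in> {0<..}" using \<epsilon>2 by simp
      show "?L \<le> (INF \<theta>\<in>{0<..}. INF F\<in>{F. finite F \<and> F \<noteq> {} \<and> F \<subseteq> carrier \<Gamma>}. INF \<delta>\<in>{0<..}.
        mdim_term d \<sigma> X \<alpha> \<pi> \<rho>X2 \<rho>Y2 \<epsilon>2 \<theta> F \<delta>)"
      \<comment> \<open>Every choice of parameters on the right is matched on the left up to an
        arbitrary \<open>\<eta>\<close>, which then tends to 0.\<close>
      proof (intro INF_greatest, rule ereal_le_epsilon2)
      fix \<theta>2 \<delta>2 \<eta> :: real and F2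
      assume "\<theta>2 \<in> {0<..}" "F2 \<in> {F. finite F \<and> F \<noteq> {} \<and> F \<subseteq> carrier \<Gamma>}" "\<delta>2 \<in> {0<..}" "\<eta> > 0"
      then have "\<theta>2 > 0" "finite F2" "F2 \<noteq> {}" "F2 \<subseteq> carrier \<Gamma>" "\<delta>2 > 0" "\<eta> > 0" by simp_all
      from ex[OF this] obtain \<theta>1 F1 \<delta>1
        where "\<theta>1 > 0" "finite F1" "F1 \<noteq> {}" "F1 \<subseteq> carrier \<Gamma>" "\<delta>1 > 0"
        and le: "mdim_term d \<sigma> X \<alpha> \<pi> \<rho>X1 \<rho>Y1 \<epsilon>1 \<theta>1 F1 \<delta>1 \<le> mdim_term d \<sigma> X \<alpha> \<pi> \<rho>X2 \<rho>Y2 \<epsilon>2 \<theta>2 F2 \<delta>2 + ereal \<eta>"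
        by blast
      then have 1: "\<theta>1 \<in> {0<..}" "F1 \<in> {F. finite F \<and> F \<noteq> {} \<and> F \<subseteq> carrier \<Gamma>}" "\<delta>1 \<in> {0<..}"
        by simp_all
      show "?L \<le> mdim_term d \<sigma> X \<alpha> \<pi> \<rho>X2 \<rho>Y2 \<epsilon>2 \<theta>2 F2 \<delta>2 + ereal \<eta>"
        by (rule INF_lower2[OF 1(1)], rule INF_lower2[OF 1(2)], rule INF_lower2[OF 1(3)], rule le)
      qed
    qed
  qed
qed

section \<open>Compatible metrics and the conclusion\<close>

lemma compatible_metric_imp_continuous_pseudometric:
  assumes "compatible_metric X \<rho>"
  shows "continuous_pseudometric X \<rho>"
proof -
  interpret Metric_space "topspace X" \<rho> using assms by (simp add: compatible_metric_def)
  have "mtopology = X" using assms by (simp add: compatible_metric_def)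
  then have "continuous_map (prod_topology X X) euclideanreal (\<lambda>(x, y). \<rho> x y)"
    using continuous_map_metric[of "metric (topspace X, \<rho>)"] by (simp add: mtopology_of mdist_metric)
  then show ?thesis
    unfolding continuous_pseudometric_def using commute triangle by simp
qed

text \<open>The translate by the unit already separates the points.\<close>

lemma compatible_metric_imp_dynamically_generating:
  assumes "group \<Gamma>" and sys: "dynamical_system \<Gamma> X \<alpha>" and \<rho>: "compatible_metric X \<rho>"
  shows "dynamically_generating \<Gamma> X \<alpha> \<rho>"
  unfolding dynamically_generating_def
proof (intro ballI impI)
  interpret group \<Gamma> by fact
  interpret Metric_space "topspace X" \<rho> using \<rho> by (simp add: compatible_metric_def)
  interpret group_action \<Gamma> "topspace X" \<alpha> using sys by (simp add: dynamical_system_def)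
  fix x x' assume x: "x \<in> topspace X" "x' \<in> topspace X" "x \<noteq> x'"
  obtain C where C: "\<forall>x\<in>topspace X. \<forall>x'\<in>topspace X. \<rho> x x' \<le> C"
    by (rule continuous_pseudometric_bounded[OF _ compatible_metric_imp_continuous_pseudometric[OF \<rho>]])
      (use sys in \<open>auto simp: dynamical_system_def\<close>)
  \<comment> \<open>Boundedness is needed for a member of the family to lie below the real
    supremum.\<close>
  have "bdd_above ((\<lambda>s. \<rho> (\<alpha> s x) (\<alpha> s x')) ` carrier \<Gamma>)"
    by (rule bdd_aboveI2[of _ _ C]) (use C x element_image in blast)
  from cSUP_upper[OF one_closed this]
  have "\<rho> (\<alpha> \<one>\<^bsub>\<Gamma>\<^esub> x) (\<alpha> \<one>\<^bsub>\<Gamma>\<^esub> x') \<le> (SUP s\<in>carrier \<Gamma>. \<rho> (\<alpha> s x) (\<alpha> s x'))" .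
  moreover have "\<alpha> \<one>\<^bsub>\<Gamma>\<^esub> x = x" "\<alpha> \<one>\<^bsub>\<Gamma>\<^esub> x' = x'"
    using x id_eq_one by (metis restrict_apply')+
  moreover have "\<rho> x x' > 0" using x mdist_pos_less by blast
  ultimately show "0 < (SUP s\<in>carrier \<Gamma>. \<rho> (\<alpha> s x) (\<alpha> s x'))" by simp
qed

lemma compatible_metric_exists: "metrizable_space X \<Longrightarrow> \<exists>\<rho>. compatible_metric X \<rho>"
  unfolding metrizable_space_def compatible_metric_def
  by (metis Metric_space.topspace_mtopology)

theorem proposition4p6:
  fixes \<Gamma> :: "('g, 'm) monoid_scheme"
    and d :: "nat \<Rightarrow> nat" and \<sigma> :: "nat \<Rightarrow> 'g \<Rightarrow> nat \<Rightarrow> nat"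
    and X :: "'x topology" and \<alpha> :: "'g \<Rightarrow> 'x \<Rightarrow> 'x"
    and Y :: "'y topology" and \<beta> :: "'g \<Rightarrow> 'y \<Rightarrow> 'y"
    and \<pi> :: "'x \<Rightarrow> 'y"
    and \<rho>X :: "'x \<Rightarrow> 'x \<Rightarrow> real" and \<rho>Y \<rho>Y' :: "'y \<Rightarrow> 'y \<Rightarrow> real"
  assumes "group \<Gamma>" and "countable (carrier \<Gamma>)"
    and "sofic_approximation \<Gamma> d \<sigma>"
    and "dynamical_system \<Gamma> X \<alpha>" and "dynamical_system \<Gamma> Y \<beta>"
    and "factor_map \<Gamma> X \<alpha> Y \<beta> \<pi>"
    and "continuous_pseudometric X \<rho>X" and "dynamically_generating \<Gamma> X \<alpha> \<rho>X"
    and "continuous_pseudometric Y \<rho>Y" and "dynamically_generating \<Gamma> Y \<beta> \<rho>Y"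
    and "continuous_pseudometric Y \<rho>Y'" and "dynamically_generating \<Gamma> Y \<beta> \<rho>Y'"
  shows "mdim \<Gamma> d \<sigma> X \<alpha> \<pi> \<rho>X \<rho>Y = mdim \<Gamma> d \<sigma> X \<alpha> \<pi> \<rho>X \<rho>Y'
       \<and> mdim_rel \<Gamma> d \<sigma> X \<alpha> Y \<pi> = mdim \<Gamma> d \<sigma> X \<alpha> \<pi> \<rho>X \<rho>Y"
proof
  note le = mdim_le[OF assms(1,3-6)]
  show "mdim \<Gamma> d \<sigma> X \<alpha> \<pi> \<rho>X \<rho>Y = mdim \<Gamma> d \<sigma> X \<alpha> \<pi> \<rho>X \<rho>Y'"
    by (rule antisym; rule le; fact)
  have eq: "mdim \<Gamma> d \<sigma> X \<alpha> \<pi> \<rho>1 \<rho>2 = mdim \<Gamma> d \<sigma> X \<alpha> \<pi> \<rho>X \<rho>Y"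
    if "compatible_metric X \<rho>1" "compatible_metric Y \<rho>2" for \<rho>1 \<rho>2
    by (rule antisym; rule le; (fact | rule compatible_metric_imp_continuous_pseudometric
          compatible_metric_imp_dynamically_generating; fact))
  \<comment> \<open>Existence of compatible metrics makes the value in \<open>mdim_rel\<close>
    unique: without a pair to test, every \<open>m\<close> would satisfy its description.\<close>
  obtain \<rho>1 \<rho>2 where "compatible_metric X \<rho>1" "compatible_metric Y \<rho>2"
    using compatible_metric_exists assms(4,5) unfolding dynamical_system_def by metis
  then show "mdim_rel \<Gamma> d \<sigma> X \<alpha> Y \<pi> = mdim \<Gamma> d \<sigma> X \<alpha> \<pi> \<rho>X \<rho>Y"
    unfolding mdim_rel_def using eq by (intro the_equality) auto
qed

end
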